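(* Let $X=(X,d)$ be a complete metric space with $0<\dim_A X<\infty$. Then for every real number $s>\dim_A X$ there is a measure $\mu$ on $X$ (with $\operatorname{spt}\mu=X$) such that $\dim_A\mu=s$.
   Context: For a metric space $(X,d)$, $B(x,R)=\{y\in X: d(x,y)\le R\}$ denotes the closed ball, and $N(x,R,r)$ denotes the minimal number of closed balls of radius $r$ needed to cover $B(x,R)$. The Assouad dimension $\dim_A X$ is the infimum of those $\alpha\ge 0$ for which there is a constant $0<C<\infty$ (independent of $x,r,R$) such that $$N(x,R,r)\le C\left(\frac{R}{r}\right)^\alpha\quad\text{for all }x\in X,\ 0<r<R<\infty;$$ if there is no such $\alpha\in[0,\infty)$, then $\dim_A X=\infty$. There is no upper bound imposed on $R$, and $X$ may be unbounded. A measure on $X$ means a Borel regular outer measure on $X$. All measures are assumed to be fully supported, that is, $\operatorname{spt}\mu=X$ (every ball of positive radius has positive measure), and balls have finite measure so that the ratios below make sense. The Assouad dimension $\dim_A\mu$ of a measure $\mu$ is the infimum of those $\alpha\ge 0$ for which there is a constant $C<\infty$ (independent of $x,r,R$) such that $$\frac{\mu(B(x,R))}{\mu(B(x,r))}\le C\left(\frac{R}{r}\right)^\alpha\quad\text{for all }x\in X,\ 0<r<R<\infty;$$ if there is no such $\alpha<\infty$, then $\dim_A\mu=\infty$. *)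

theory Defs
  imports "HOL-Analysis.Analysis"
begin

(* The value is \<infinity> if the ball has no finite cover, since Inf {} = \<infinity> in enat. *)
definition covering_number :: "'a::metric_space \<Rightarrow> real \<Rightarrow> real \<Rightarrow> enat" where
  "covering_number x R r =
     Inf {enat (card F) |F. finite F \<and> cball x R \<subseteq> (\<Union>y\<in>F. cball y r)}"

(* Both dimensions below are infima in ereal, so Inf {} = \<infinity> gives the convention that the
   dimension is \<infinity> when there is no admissible exponent. *)
definition assouad_dim :: "'a::metric_space itself \<Rightarrow> ereal" where
  "assouad_dim _ =
     Inf {ereal \<alpha> |\<alpha>. 0 \<le> \<alpha> \<and>
       (\<exists>C::real. 0 < C \<and>
         (\<forall>(x::'a) r R. 0 < r \<and> r < R \<longrightarrow>
           ereal_of_enat (covering_number x R r) \<le> ereal (C * (R / r) powr \<alpha>)))}"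

(* The lambda system of an outer measure is the family of its Caratheodory measurable sets.
   The library's countable subadditivity speaks of disjoint families only; for an increasing
   function on all subsets this is equivalent to the version for arbitrary sequences. *)
definition borel_regular_outer_measure :: "('a::topological_space set \<Rightarrow> ennreal) \<Rightarrow> bool" where
  "borel_regular_outer_measure \<mu> \<longleftrightarrow>
     outer_measure_space (Pow UNIV) \<mu> \<and>
     sets borel \<subseteq> lambda_system UNIV (Pow UNIV) \<mu> \<and>
     (\<forall>A. \<exists>B\<in>sets borel. A \<subseteq> B \<and> \<mu> B = \<mu> A)"

definition spt :: "('a::metric_space set \<Rightarrow> ennreal) \<Rightarrow> 'a set" where
  "spt \<mu> = {x. \<forall>r>0. 0 < \<mu> (cball x r)}"

(* Intended for \<mu> with positive and finite values on balls of positive radius; the quotient is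
   then an ordinary one. *)
definition assouad_dim_measure :: "('a::metric_space set \<Rightarrow> ennreal) \<Rightarrow> ereal" where
  "assouad_dim_measure \<mu> =
     Inf {ereal \<alpha> |\<alpha>. 0 \<le> \<alpha> \<and>
       (\<exists>C::real. \<forall>x r R. 0 < r \<and> r < R \<longrightarrow>
         \<mu> (cball x R) / \<mu> (cball x r) \<le> ennreal (C * (R / r) powr \<alpha>))}"

end

theory Submission
  imports Defs "HOL-Probability.Probability"
begin

text \<open>
  For small \<open>\<delta>\<close> choose a maximal \<open>\<delta>\<^sup>k\<close>-separated set for every integer \<open>k\<close>, all containing a fixed
  point, and join each point of level \<open>k\<close> to a nearby point of level \<open>k - 1\<close>. Any two branches of
  this tree merge, because all of them eventually reach the fixed point. Distribute mass down the
  tree, giving the fraction \<open>\<delta>\<^sup>t\<close> to every child except a central one, which receives the rest; the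
  law of the endpoint of the resulting random path is a measure \<open>\<mu>\<^sub>t\<close>. Neighbouring nodes have
  comparable mass, since up to their common ancestor they avoid central children, so the
  admissible exponents of \<open>\<mu>\<^sub>t\<close> can be read off from the weights of the branches. It follows that
  \<open>f t = dim\<^sub>A \<mu>\<^sub>t\<close> satisfies \<open>f t \<le> t\<close> and is 1-Lipschitz. It is unbounded: interpolating between
  the weights for \<open>t\<close> and those for a smaller parameter shows that a bound on \<open>f\<close> would force
  \<open>dim\<^sub>A X = 0\<close>. The intermediate value theorem yields \<open>f t = s\<close>.
\<close>

section \<open>Outer measures and separated sets\<close>

lemma ennreal_divide_mono:
  fixes a b c d :: ennreal
  assumes "a \<le> c" "d \<le> b"
  shows "a / b \<le> c / d"
proof -
  have "inverse b \<le> inverse d"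
    using assms(2) including ennreal.lifting by transfer (rule ereal_inverse_antimono)
  with assms(1) show ?thesis unfolding divide_ennreal_def by (intro mult_mono) auto
qed

text \<open>Every set lies in a measurable hull of equal outer measure. Passing to hulls transfers
  subadditivity and both halves of the Caratheodory identity from \<open>M\<close>, and the hull is
  the Borel set that regularity asks for.\<close>

lemma borel_regular_outer_measure_of:
  fixes M :: "'a::topological_space measure"
  assumes sets: "sets M = sets borel"
  shows "borel_regular_outer_measure (outer_measure_of M)"
proof -
  let ?f = "outer_measure_of M"
  have "space M = UNIV" using sets_eq_imp_space_eq[OF sets] by simp
  then have attain: "\<exists>E\<in>sets M. A \<subseteq> E \<and> ?f A = emeasure M E" for A
    by (intro outer_measure_of_attain) simp
  have "outer_measure_space (Pow UNIV) ?f"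
    unfolding outer_measure_space_def
  proof (intro conjI)
    show "positive (Pow UNIV) ?f" by (simp add: positive_def)
    show "increasing (Pow UNIV) ?f" by (auto simp: increasing_def intro: outer_measure_of_mono)
    show "countably_subadditive (Pow UNIV) ?f"
      unfolding countably_subadditive_def
    proof (intro allI impI)
      fix A :: "nat \<Rightarrow> 'a set"
      obtain E where E: "\<And>i. E i \<in> sets M" "\<And>i. A i \<subseteq> E i" "\<And>i. ?f (A i) = emeasure M (E i)"
      proof -
        have "\<exists>E. \<forall>i. E i \<in> sets M \<and> A i \<subseteq> E i \<and> ?f (A i) = emeasure M (E i)"
          using attain by (intro choice) blast
        then show ?thesis using that by blast
      qed
      have "?f (\<Union>i. A i) \<le> ?f (\<Union>i. E i)" using E(2) by (intro outer_measure_of_mono) blast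
      also have "\<dots> = emeasure M (\<Union>i. E i)" using E(1) by simp
      also have "\<dots> \<le> (\<Sum>i. emeasure M (E i))"
        using E(1) by (intro emeasure_subadditive_countably) auto
      finally show "?f (\<Union>i. A i) \<le> (\<Sum>i. ?f (A i))" by (simp add: E(3))
    qed
  qed
  moreover have "sets borel \<subseteq> lambda_system UNIV (Pow UNIV) ?f"
  proof
    fix B :: "'a set" assume "B \<in> sets borel"
    then have B: "B \<in> sets M" using sets by simp
    have "?f (B \<inter> A) + ?f ((UNIV - B) \<inter> A) = ?f A" for A
    proof (rule antisym)
      obtain E where E: "E \<in> sets M" "A \<subseteq> E" "?f A = emeasure M E" using attain by blast
      have "?f (B \<inter> A) + ?f ((UNIV - B) \<inter> A) \<le> ?f (E \<inter> B) + ?f (E - B)"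
        using E(2) by (intro add_mono outer_measure_of_mono) auto
      also have "\<dots> = emeasure M (E \<inter> B) + emeasure M (E - B)" using E B by simp
      also have "\<dots> = ?f A"
        unfolding E(3) using E B by (subst plus_emeasure) (auto intro!: arg_cong[where f = "emeasure M"])
      finally show "?f (B \<inter> A) + ?f ((UNIV - B) \<inter> A) \<le> ?f A" .
      obtain E1 where E1: "E1 \<in> sets M" "B \<inter> A \<subseteq> E1" "?f (B \<inter> A) = emeasure M E1"
        using attain by blast
      obtain E2 where E2: "E2 \<in> sets M" "(UNIV - B) \<inter> A \<subseteq> E2" "?f ((UNIV - B) \<inter> A) = emeasure M E2"
        using attain by blast
      have "?f A \<le> ?f (E1 \<union> E2)" using E1 E2 by (intro outer_measure_of_mono) blast
      also have "\<dots> = emeasure M (E1 \<union> E2)" using E1 E2 by simp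
      also have "\<dots> \<le> emeasure M E1 + emeasure M E2"
        using E1 E2 by (intro emeasure_subadditive) auto
      finally show "?f A \<le> ?f (B \<inter> A) + ?f ((UNIV - B) \<inter> A)" by (simp add: E1 E2)
    qed
    then show "B \<in> lambda_system UNIV (Pow UNIV) ?f" by (simp add: lambda_system_def)
  qed
  moreover have "\<exists>B\<in>sets borel. A \<subseteq> B \<and> ?f B = ?f A" for A
    using attain[of A] sets by auto
  ultimately show ?thesis unfolding borel_regular_outer_measure_def by blast
qed

text \<open>Zorn's lemma, applied to the separated sets that contain \<open>x0\<close>. A point at
  distance at least \<open>r\<close> from all of a maximal one could be added to it.\<close>

lemma ex_maximal_separated:
  fixes x0 :: "'a::metric_space"
  assumes "0 < r"
  obtains S where "x0 \<in> S" "\<And>x y. x \<in> S \<Longrightarrow> y \<in> S \<Longrightarrow> x \<noteq> y \<Longrightarrow> r \<le> dist x y"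
    "\<And>x. \<exists>y\<in>S. dist x y < r"
proof -
  define \<A> where "\<A> = {S. x0 \<in> S \<and> (\<forall>x\<in>S. \<forall>y\<in>S. x \<noteq> y \<longrightarrow> r \<le> dist x y)}"
  have "\<exists>S\<in>\<A>. \<forall>T\<in>\<A>. S \<subseteq> T \<longrightarrow> T = S"
  proof (rule subset_Zorn)
    fix \<C> assume \<C>: "subset.chain \<A> \<C>"
    then have sub: "\<C> \<subseteq> \<A>" by (auto simp: subset.chain_def)
    show "\<exists>U\<in>\<A>. \<forall>T\<in>\<C>. T \<subseteq> U"
    proof (cases "\<C> = {}")
      case True
      then show ?thesis by (auto simp: \<A>_def intro!: exI[of _ "{x0}"])
    next
      case False
      have "r \<le> dist x y" if "x \<in> \<Union>\<C>" "y \<in> \<Union>\<C>" "x \<noteq> y" for x y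
      proof -
        obtain S T where ST: "S \<in> \<C>" "x \<in> S" "T \<in> \<C>" "y \<in> T" using \<open>x \<in> \<Union>\<C>\<close> \<open>y \<in> \<Union>\<C>\<close> by blast
        have "S \<subseteq> T \<or> T \<subseteq> S" using \<C> ST by (auto simp: subset.chain_def)
        then have "\<exists>U\<in>\<C>. x \<in> U \<and> y \<in> U" using ST by blast
        then show ?thesis using sub that by (auto simp: \<A>_def)
      qed
      then have "\<Union>\<C> \<in> \<A>" using False sub by (auto simp: \<A>_def)
      then show ?thesis by blast
    qed
  qed
  then obtain S where S: "S \<in> \<A>" and max: "\<And>T. T \<in> \<A> \<Longrightarrow> S \<subseteq> T \<Longrightarrow> T = S" by blast
  have "\<exists>y\<in>S. dist x y < r" for x
  proof (rule ccontr)
    assume far: "\<not> (\<exists>y\<in>S. dist x y < r)"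
    then have "insert x S \<in> \<A>" using S by (auto simp: \<A>_def dist_commute not_less)
    then have "x \<in> S" using max by blast
    then show False using far assms by auto
  qed
  then show ?thesis using S that by (auto simp: \<A>_def)
qed

text \<open>Two points of one ball of radius \<open>r\<close> are at distance at most
  \<open>2 * r\<close>, so each ball of an optimal cover contains at most one point of
  \<open>S\<close>.\<close>

lemma card_separated_le_covering_number:
  fixes x :: "'a::metric_space" and b :: real
  assumes sep: "\<And>u v. u \<in> S \<Longrightarrow> v \<in> S \<Longrightarrow> u \<noteq> v \<Longrightarrow> 2 * r < dist u v"
    and cover: "ereal_of_enat (covering_number x R r) \<le> ereal b"
  shows "finite (S \<inter> cball x R)" "card (S \<inter> cball x R) \<le> b"
proof -
  let ?A = "{enat (card F) |F. finite F \<and> cball x R \<subseteq> (\<Union>y\<in>F. cball y r)}"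
  \<comment> \<open>The finite bound excludes the value \<infinity> of \<open>Inf {}\<close>, so the
    infimum is attained by an actual cover.\<close>
  have "covering_number x R r \<noteq> \<infinity>" using cover by (intro notI) simp
  then have "?A \<noteq> {}" unfolding covering_number_def by (intro notI) (simp add: Inf_enat_def)
  then obtain a where "a \<in> ?A" by blast
  then have "Inf ?A \<in> ?A" by (rule wellorder_InfI)
  then obtain F where F: "finite F" "cball x R \<subseteq> (\<Union>y\<in>F. cball y r)"
    "covering_number x R r = enat (card F)" unfolding covering_number_def by blast
  have "\<forall>v\<in>cball x R. \<exists>y. y \<in> F \<and> dist y v \<le> r" using F(2) by (auto simp: subset_eq)
  then have "\<exists>g. \<forall>v\<in>cball x R. g v \<in> F \<and> dist (g v) v \<le> r" by (rule bchoice)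
  then obtain g where g: "\<And>v. v \<in> cball x R \<Longrightarrow> g v \<in> F \<and> dist (g v) v \<le> r" by blast
  have inj: "inj_on g (S \<inter> cball x R)"
  proof (rule inj_onI, rule ccontr)
    fix u v assume uv: "u \<in> S \<inter> cball x R" "v \<in> S \<inter> cball x R" "g u = g v" "u \<noteq> v"
    have "dist u v \<le> dist (g u) u + dist (g u) v" by (rule dist_triangle3)
    also have "\<dots> \<le> 2 * r" using g[of u] g[of v] uv by simp
    finally show False using sep[of u v] uv by simp
  qed
  have sub: "g ` (S \<inter> cball x R) \<subseteq> F" using g by blast
  show "finite (S \<inter> cball x R)" using inj sub F(1) by (rule inj_on_finite)
  have "card (S \<inter> cball x R) \<le> card F" using inj sub F(1) by (rule card_inj_on_le)
  also have "real (card F) \<le> b" using cover F(3) by simp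
  finally show "card (S \<inter> cball x R) \<le> b" by simp
qed

section \<open>Trees of nets\<close>

text \<open>Larger \<open>k\<close> means a finer scale, and the nets need not be nested.
  \<open>card_net\<close> is a doubling condition uniform in the level; \<open>delta_le\<close>
  leaves room for the distance estimate in \<open>edge_eq_p\<close>.\<close>

locale net_tree =
  fixes \<delta> :: real and net :: "int \<Rightarrow> 'a::complete_space set" and x0 :: 'a and K e :: real
  assumes delta_pos: "0 < \<delta>" and delta_le: "\<delta> \<le> 1/24"
    and base: "x0 \<in> net k"
    and separated: "x \<in> net k \<Longrightarrow> y \<in> net k \<Longrightarrow> x \<noteq> y \<Longrightarrow> \<delta> powi k \<le> dist x y"
    and dense: "\<exists>y\<in>net k. dist x y < \<delta> powi k"
    and finite_net: "finite (net k \<inter> cball x R)"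
    and card_net: "1 \<le> \<rho> \<Longrightarrow> card (net k \<inter> cball x (\<rho> * \<delta> powi k)) \<le> K * \<rho> powr e"
begin

abbreviation sc :: "int \<Rightarrow> real" where "sc k \<equiv> \<delta> powi k"

lemma sc_pos: "0 < sc k"
  by (simp add: delta_pos zero_less_power_int)

lemma sc_Suc: "sc k = \<delta> * sc (k - 1)"
  using power_int_add[of \<delta> 1 "k - 1"] delta_pos by simp

lemma sc_diff_nat: "sc k = \<delta> ^ n * sc (k - int n)"
  using power_int_add[of \<delta> "int n" "k - int n"] delta_pos by simp

lemma sc_le_pred: "24 * sc k \<le> sc (k - 1)"
  using mult_right_mono[OF delta_le, of "sc (k - 1)"] sc_Suc[of k] sc_pos[of "k - 1"] by simp

lemma sc_antimono: "j \<le> k \<Longrightarrow> sc k \<le> sc j"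
  using delta_pos delta_le by (intro power_int_decreasing) auto

lemma sc_less_iff: "sc k < sc j \<longleftrightarrow> j < k"
  using delta_pos delta_le power_int_strict_decreasing[of j k \<delta>] sc_antimono[of k j] by fastforce

lemma ex_scale:
  assumes "0 < r"
  obtains k where "sc k \<le> r" "r < sc (k - 1)"
proof -
  define k where "k = \<lceil>ln r / ln \<delta>\<rceil>"
  have l: "ln \<delta> < 0" using delta_pos delta_le by (simp add: ln_less_zero)
  have eq: "sc i = exp (of_int i * ln \<delta>)" for i
    using delta_pos by (metis exp_ln ln_powr powr_gt_zero powr_real_of_int' order_less_imp_le less_numeral_extra(3))
  have "ln r / ln \<delta> \<le> of_int k" "of_int (k - 1) < ln r / ln \<delta>" unfolding k_def by linarith+
  then have "of_int k * ln \<delta> \<le> ln r" "ln r < of_int (k - 1) * ln \<delta>"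
    using l by (simp_all add: field_simps)
  then have "sc k \<le> r" "r < sc (k - 1)"
    unfolding eq using assms by (metis exp_le_cancel_iff exp_ln, metis exp_less_cancel_iff exp_ln)
  then show ?thesis by (rule that)
qed

lemma K_ge_1: "1 \<le> K"
proof -
  have "{x0} \<subseteq> net 0 \<inter> cball x0 (1 * sc 0)" using base by simp
  then have "card {x0} \<le> card (net 0 \<inter> cball x0 (1 * sc 0))"
    by (rule card_mono[OF finite_net])
  then show ?thesis using card_net[of 1 0 x0] by simp
qed

text \<open>In \<open>par\<close>, \<open>cen\<close>, \<open>children\<close> and \<open>edge\<close> the level \<open>k\<close> is that of the child. The last clause of
  \<open>par\<close> forces every point near a node \<open>z\<close> of level \<open>k - 1\<close> to have \<open>z\<close> as its parent.\<close>

definition par :: "int \<Rightarrow> 'a \<Rightarrow> 'a" where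
  "par k y = (SOME z. z \<in> net (k - 1) \<and> dist y z < sc (k - 1) \<and>
     ((\<exists>z'\<in>net (k - 1). dist y z' < sc (k - 1) / 2) \<longrightarrow> dist y z < sc (k - 1) / 2))"

lemma par_props:
  "par k y \<in> net (k - 1)" "dist y (par k y) < sc (k - 1)"
  "(\<exists>z'\<in>net (k - 1). dist y z' < sc (k - 1) / 2) \<Longrightarrow> dist y (par k y) < sc (k - 1) / 2"
proof -
  have "\<exists>z. z \<in> net (k - 1) \<and> dist y z < sc (k - 1) \<and>
     ((\<exists>z'\<in>net (k - 1). dist y z' < sc (k - 1) / 2) \<longrightarrow> dist y z < sc (k - 1) / 2)"
  proof (cases "\<exists>z'\<in>net (k - 1). dist y z' < sc (k - 1) / 2")
    case True
    then obtain z where "z\<in>net (k - 1)" "dist y z < sc (k - 1) / 2" by blast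
    then show ?thesis using sc_pos[of "k - 1"] by (intro exI[of _ z]) auto
  next
    case False
    then show ?thesis using dense[of "k - 1" y] by blast
  qed
  from someI_ex[OF this] show "par k y \<in> net (k - 1)" "dist y (par k y) < sc (k - 1)"
    "(\<exists>z'\<in>net (k - 1). dist y z' < sc (k - 1) / 2) \<Longrightarrow> dist y (par k y) < sc (k - 1) / 2"
    unfolding par_def by blast+
qed

text \<open>A node within half of the separation distance is unique, and the last clause of
  \<open>par\<close> makes the parent such a node.\<close>

lemma par_eqI:
  assumes z: "z \<in> net (k - 1)" and d: "dist y z < sc (k - 1) / 2"
  shows "par k y = z"
proof (rule ccontr)
  assume "par k y \<noteq> z"
  then have "sc (k - 1) \<le> dist (par k y) z" using separated par_props(1) z by blast
  also have "\<dots> \<le> dist y (par k y) + dist y z" by (rule dist_triangle3)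
  finally show False using d par_props(3)[of k y] z by fastforce
qed

lemma par_x0: "par k x0 = x0"
  using base sc_pos by (intro par_eqI) auto

text \<open>The node \<open>z\<close> itself may be missing from level \<open>k\<close>; a nearby
  point of \<open>net k\<close> takes its place.\<close>

definition cen :: "int \<Rightarrow> 'a \<Rightarrow> 'a" where
  "cen k z = (SOME y. y \<in> net k \<and> dist z y < sc k)"

lemma cen_props: "cen k z \<in> net k" "dist z (cen k z) < sc k"
proof -
  have "\<exists>y. y \<in> net k \<and> dist z y < sc k" using dense by blast
  from someI_ex[OF this] show "cen k z \<in> net k" "dist z (cen k z) < sc k"
    unfolding cen_def by blast+
qed

lemma par_cen:
  assumes "z \<in> net (k - 1)"
  shows "par k (cen k z) = z"
  using cen_props(2)[of z k] sc_le_pred[of k] sc_pos[of k] assms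
  by (intro par_eqI) (auto simp: dist_commute)

definition children :: "int \<Rightarrow> 'a \<Rightarrow> 'a set" where
  "children k z = {y \<in> net k. par k y = z}"

text \<open>The bound of \<open>card_net\<close> at \<open>\<rho> = 1 / \<delta>\<close>, because
  children lie within \<open>sc (k - 1)\<close> of their parent.\<close>

definition branching :: real where "branching = K * (1 / \<delta>) powr e"

lemma children_subset: "children k z \<subseteq> net k \<inter> cball z ((1 / \<delta>) * sc k)"
proof
  fix y assume "y \<in> children k z"
  then have "y \<in> net k" "dist y z < sc (k - 1)" using par_props(2)[of y k] by (auto simp: children_def)
  moreover have "(1 / \<delta>) * sc k = sc (k - 1)" using sc_Suc[of k] delta_pos by simp
  ultimately show "y \<in> net k \<inter> cball z ((1 / \<delta>) * sc k)" by (simp add: dist_commute)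
qed

lemma finite_children: "finite (children k z)"
  using children_subset finite_net by (rule finite_subset)

lemma card_children_le: "card (children k z) \<le> branching"
proof -
  have "card (children k z) \<le> card (net k \<inter> cball z ((1 / \<delta>) * sc k))"
    using children_subset by (intro card_mono finite_net)
  also have "real \<dots> \<le> branching" unfolding branching_def
    using delta_pos delta_le by (intro card_net) (auto simp: field_simps)
  finally show ?thesis by simp
qed

lemma cen_in_children: "z \<in> net (k - 1) \<Longrightarrow> cen k z \<in> children k z"
  by (simp add: children_def cen_props(1) par_cen)

lemma card_children_ge_1: "z \<in> net (k - 1) \<Longrightarrow> 1 \<le> card (children k z)"
  using cen_in_children[of z k] finite_children[of k z] by (metis One_nat_def Suc_leI card_gt_0_iff empty_iff)

fun up :: "int \<Rightarrow> nat \<Rightarrow> 'a \<Rightarrow> 'a" where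
  "up k 0 y = y"
| "up k (Suc n) y = up (k - 1) n (par k y)"

lemma up_in_net: "y \<in> net k \<Longrightarrow> up k n y \<in> net (k - int n)"
proof (induction n arbitrary: k y)
  case (Suc n)
  then show ?case using Suc.IH[OF par_props(1)[of k y]] by (simp add: algebra_simps)
qed simp

lemma up_add: "up k (m + n) y = up (k - int m) n (up k m y)"
  by (induction m arbitrary: k y) (auto simp: algebra_simps)

lemma up_Suc_right: "up k (Suc n) y = par (k - int n) (up k n y)"
  using up_add[of k n 1 y] by simp

lemma up_x0: "up k n x0 = x0"
  by (induction n arbitrary: k) (simp_all add: par_x0)

text \<open>The jumps up the tree grow geometrically in length, so the last one dominates their
  sum.\<close>

lemma dist_up_le: "dist (up k n y) y \<le> 2 * sc (k - int n)"
proof (induction n)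
  case 0
  then show ?case using sc_pos[of k] by simp
next
  case (Suc n)
  have "dist (up k (Suc n) y) y \<le> dist (up k n y) (par (k - int n) (up k n y)) + dist (up k n y) y"
    unfolding up_Suc_right by (rule dist_triangle3)
  also have "\<dots> \<le> sc (k - int n - 1) + 2 * sc (k - int n)"
    using Suc par_props(2)[of "up k n y" "k - int n"] by linarith
  also have "\<dots> \<le> 2 * sc (k - int n - 1)"
    using sc_le_pred[of "k - int n"] sc_pos[of "k - int n"] by simp
  finally show ?case by (simp add: algebra_simps)
qed

text \<open>Ancestors of \<open>y\<close> stay within twice their scale of \<open>y\<close>. Once
  that scale exceeds \<open>dist y x0\<close>, the ancestor is so close to \<open>x0\<close> that
  \<open>par_eqI\<close> makes \<open>x0\<close> its parent.\<close>

lemma up_eventually_x0: "\<exists>n. up k n y = x0"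
proof -
  obtain j where j: "dist y x0 + 1 < sc (j - 1)" "sc j \<le> dist y x0 + 1"
    using ex_scale[of "dist y x0 + 1"] by (metis add_nonneg_pos zero_le_dist zero_less_one)
  define n where "n = nat (k - j + 2)"
  have "sc (k - int n) \<ge> sc (j - 1)"
    by (rule sc_antimono) (simp add: n_def)
  have "dist (up k n y) x0 \<le> dist (up k n y) y + dist y x0" by (rule dist_triangle)
  also have "\<dots> \<le> 3 * sc (k - int n)"
    using dist_up_le[of k n y] j(1) \<open>sc (k - int n) \<ge> sc (j - 1)\<close> by linarith
  also have "\<dots> < sc (k - int n - 1) / 2"
    using sc_le_pred[of "k - int n"] sc_pos[of "k - int n"] by linarith
  finally have "par (k - int n) (up k n y) = x0"
    using base by (intro par_eqI) auto
  then have "up k (Suc n) y = x0" by (simp only: up_Suc_right)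
  then show ?thesis by blast
qed

section \<open>Transition weights along branches\<close>

definition edge :: "real \<Rightarrow> int \<Rightarrow> 'a \<Rightarrow> real" where
  "edge p k y = (if y = cen k (par k y) then 1 - (real (card (children k (par k y))) - 1) * p else p)"

text \<open>To be read as the conditional probability that a path descending from
  \<open>up k n y\<close> reaches \<open>y\<close>.\<close>

fun weight :: "real \<Rightarrow> int \<Rightarrow> nat \<Rightarrow> 'a \<Rightarrow> real" where
  "weight p k 0 y = 1"
| "weight p k (Suc n) y = edge p k y * weight p (k - 1) n (par k y)"

lemma weight_add: "weight p k (m + n) y = weight p k m y * weight p (k - int m) n (up k m y)"
  by (induction m arbitrary: k y) (auto simp: algebra_simps)

lemma weight_Suc_right: "weight p k (Suc n) y = weight p k n y * edge p (k - int n) (up k n y)"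
  using weight_add[of p k n 1 y] by simp

lemma edge_central_ge:
  assumes "0 \<le> p" "z \<in> net (k - 1)"
  shows "1 - branching * p \<le> 1 - (real (card (children k z)) - 1) * p"
    "1 - (real (card (children k z)) - 1) * p \<le> 1"
proof -
  have "real (card (children k z)) - 1 \<le> branching" using card_children_le[of k z] by linarith
  then show "1 - branching * p \<le> 1 - (real (card (children k z)) - 1) * p"
    using mult_right_mono[of _ _ p] assms by fastforce
  show "1 - (real (card (children k z)) - 1) * p \<le> 1"
    using assms card_children_ge_1[of z k] by simp
qed

lemma branching_ge_1: "1 \<le> branching"
  using card_children_le[of 1 x0] card_children_ge_1[of x0 1] base by fastforce

lemma sum_edge:
  assumes z: "z \<in> net (k - 1)"
  shows "(\<Sum>y\<in>children k z. edge p k y) = 1"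
proof -
  let ?c = "cen k z"
  have "(\<Sum>y\<in>children k z. edge p k y) = edge p k ?c + (\<Sum>y\<in>children k z - {?c}. edge p k y)"
    using cen_in_children[OF z] finite_children by (intro sum.remove) auto
  also have "(\<Sum>y\<in>children k z - {?c}. edge p k y) = (\<Sum>y\<in>children k z - {?c}. p)"
    by (intro sum.cong) (auto simp: edge_def children_def)
  also have "\<dots> = (real (card (children k z)) - 1) * p"
    using cen_in_children[OF z] card_children_ge_1[OF z]
    by (simp add: card_Diff_singleton of_nat_diff del: One_nat_def)
  finally show ?thesis by (simp add: edge_def par_cen z)
qed

definition desc :: "int \<Rightarrow> nat \<Rightarrow> 'a \<Rightarrow> 'a set" where
  "desc k n z = {y \<in> net k. up k n y = z}"

lemma finite_desc: "finite (desc k n z)"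
proof (rule finite_subset)
  show "desc k n z \<subseteq> net k \<inter> cball z (2 * sc (k - int n))"
    using dist_up_le by (auto simp: desc_def)
qed (rule finite_net)

lemma desc_Suc: "desc k (Suc n) z = (\<Union>v\<in>desc (k - 1) n z. children k v)"
  using par_props(1) by (auto simp: desc_def children_def)

text \<open>Stated for arbitrary \<open>g\<close> and later applied to \<open>mass\<close>; the
  generations are summed out one at a time, the finest first.\<close>

lemma sum_desc:
  assumes step: "\<And>k v. v \<in> net (k - 1) \<Longrightarrow> (\<Sum>y\<in>children k v. g k y) = g (k - 1) v"
    and z: "z \<in> net (k - int n)"
  shows "(\<Sum>y\<in>desc k n z. g k y) = g (k - int n) z"
  using z
proof (induction n arbitrary: k)
  case 0
  then have "desc k 0 z = {z}" by (auto simp: desc_def)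
  then show ?case by simp
next
  case (Suc n)
  have "(\<Sum>y\<in>desc k (Suc n) z. g k y) = (\<Sum>v\<in>desc (k - 1) n z. \<Sum>y\<in>children k v. g k y)"
    unfolding desc_Suc
    by (rule sum.UNION_disjoint) (use finite_children in \<open>auto simp: finite_desc children_def\<close>)
  also have "\<dots> = (\<Sum>v\<in>desc (k - 1) n z. g (k - 1) v)"
    by (intro sum.cong step refl) (auto simp: desc_def)
  also have "\<dots> = g (k - 1 - int n) z" using Suc.prems by (intro Suc.IH) (simp add: algebra_simps)
  finally show ?case by (simp add: algebra_simps)
qed

lemma sum_weight_desc:
  assumes z: "z \<in> net (k - int n)"
  shows "(\<Sum>y\<in>desc k n z. weight p k n y) = 1"
  using z
proof (induction n arbitrary: k)
  case 0
  then have "desc k 0 z = {z}" by (auto simp: desc_def)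
  then show ?case by simp
next
  case (Suc n)
  have "(\<Sum>y\<in>desc k (Suc n) z. weight p k (Suc n) y)
      = (\<Sum>v\<in>desc (k - 1) n z. \<Sum>y\<in>children k v. weight p k (Suc n) y)"
    unfolding desc_Suc
    by (rule sum.UNION_disjoint) (use finite_children in \<open>auto simp: finite_desc children_def\<close>)
  also have "\<dots> = (\<Sum>v\<in>desc (k - 1) n z. (\<Sum>y\<in>children k v. edge p k y) * weight p (k - 1) n v)"
    unfolding sum_distrib_right by (intro sum.cong refl) (auto simp: children_def)
  also have "\<dots> = (\<Sum>v\<in>desc (k - 1) n z. weight p (k - 1) n v)"
    by (intro sum.cong) (auto simp: sum_edge desc_def)
  also have "\<dots> = 1" using Suc.prems by (intro Suc.IH) (simp add: algebra_simps)
  finally show ?case .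
qed

end

section \<open>Masses of the nodes\<close>

locale weighted_net_tree = net_tree +
  fixes p :: real
  assumes p_pos: "0 < p" and p_le: "branching * p \<le> 1 / 2"
begin

lemma p_le_half: "p \<le> 1/2"
  using p_le mult_right_mono[OF branching_ge_1, of p] p_pos by linarith

text \<open>By \<open>p_le\<close> the central child keeps at least \<open>1 / 2\<close>, and
  \<open>p\<close> is at most that.\<close>

lemma edge_ge: "p \<le> edge p k y"
  unfolding edge_def
  using edge_central_ge(1)[of p "par k y" k, OF less_imp_le[OF p_pos] par_props(1)] p_le p_le_half
  by (split if_split, intro conjI impI; linarith)

lemma edge_le_1: "edge p k y \<le> 1"
  using edge_central_ge(2)[of p "par k y" k] par_props(1) p_pos p_le_half by (auto simp: edge_def)

lemma edge_pos: "0 < edge p k y"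
  using edge_ge p_pos by (rule less_le_trans[rotated])

lemma weight_pos: "0 < weight p k n y"
  by (induction n arbitrary: k y) (simp_all add: edge_pos)

lemma weight_ge: "p ^ n \<le> weight p k n y"
  by (induction n arbitrary: k y)
    (auto intro!: mult_mono edge_ge simp: p_pos less_imp_le[OF p_pos] less_imp_le[OF edge_pos])

text \<open>Nearby nodes with different parents both avoid the centres of their parents, since a central
  child lies deep inside its parent; hence their edges carry the same weight \<open>p\<close>.\<close>

lemma edge_eq_p:
  assumes d: "dist y y' \<le> 6 * sc k" and ne: "par (k - int n) (up k n y) \<noteq> par (k - int n) (up k n y')"
  shows "edge p (k - int n) (up k n y) = p"
proof (rule ccontr)
  let ?k = "k - int n" and ?u = "up k n y" and ?u' = "up k n y'"
  assume "edge p ?k ?u \<noteq> p"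
  then have c: "?u = cen ?k (par ?k ?u)" by (auto simp: edge_def split: if_splits)
  have "dist ?u' ?u \<le> dist ?u' y' + dist y' ?u" by (rule dist_triangle)
  also have "dist y' ?u \<le> dist y y' + dist ?u y" using dist_triangle[of y' ?u y] by (simp add: dist_commute)
  finally have "dist ?u' ?u \<le> 2 * sc ?k + (6 * sc k + 2 * sc ?k)"
    using d dist_up_le[of k n y] dist_up_le[of k n y'] by linarith
  moreover have "sc k \<le> sc ?k" by (rule sc_antimono) simp
  moreover have "dist ?u (par ?k ?u) < sc ?k" 
    using cen_props(2)[of "par ?k ?u" ?k] c by (simp add: dist_commute)
  moreover have "dist ?u' (par ?k ?u) \<le> dist ?u' ?u + dist ?u (par ?k ?u)" by (rule dist_triangle)
  \<comment> \<open>The distances add up to less than \<open>11 * sc ?k\<close>, while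
    \<open>\<delta> \<le> 1/24\<close> makes \<open>sc (?k - 1) / 2\<close> at least
    \<open>12 * sc ?k\<close>.\<close>
  ultimately have "dist ?u' (par ?k ?u) < sc (?k - 1) / 2" using sc_le_pred[of ?k] sc_pos[of ?k] by linarith
  then show False using par_eqI[OF par_props(1)] ne by metis
qed

text \<open>The future mass of \<open>x0\<close> on each level, normalised to 1 on level 0. On
  coarser levels it is a reciprocal weight, being recovered from the descendant \<open>x0\<close> of
  level 0.\<close>

definition spine_mass :: "int \<Rightarrow> real" where
  "spine_mass k = (if 0 \<le> k then weight p k (nat k) x0 else 1 / weight p 0 (nat (- k)) x0)"

lemma spine_mass_pos: "0 < spine_mass k"
  by (simp add: spine_mass_def weight_pos)

lemma spine_mass_rec: "spine_mass k = edge p k x0 * spine_mass (k - 1)"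
proof (cases "1 \<le> k")
  case True
  then have "nat k = Suc (nat (k - 1))" by simp
  then show ?thesis using True by (simp add: spine_mass_def par_x0)
next
  case False
  then have n: "nat (- (k - 1)) = Suc (nat (- k))" "k = 0 - int (nat (- k))" by simp_all
  have "weight p 0 (nat (- (k - 1))) x0 = weight p 0 (nat (- k)) x0 * edge p k x0"
    unfolding n(1) weight_Suc_right up_x0 using n(2) by simp
  then show ?thesis using False edge_pos[of k x0] weight_pos[of 0 _ x0] by (simp add: spine_mass_def)
qed

text \<open>There is no topmost level to start from, so \<open>y\<close> is compared with
  \<open>x0\<close> on the same level: both descend from \<open>x0\<close> on level
  \<open>k - int n\<close>, hence their masses are in the ratio of their weights. By
  \<open>mass_eq\<close> the chosen \<open>n\<close> is immaterial.\<close>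

definition mass :: "int \<Rightarrow> 'a \<Rightarrow> real" where
  "mass k y = spine_mass k * (let n = (SOME n. up k n y = x0) in weight p k n y / weight p k n x0)"

lemma mass_eq:
  assumes "up k n y = x0"
  shows "mass k y = spine_mass k * (weight p k n y / weight p k n x0)"
proof -
  have add: "weight p k (m + j) y / weight p k (m + j) x0 = weight p k m y / weight p k m x0"
    if "up k m y = x0" for m j
    using that weight_pos[of "k - int m" j x0] by (simp add: weight_add up_x0)
  define m where "m = (SOME n. up k n y = x0)"
  have "up k m y = x0" unfolding m_def using assms by (rule someI)
  then have "weight p k m y / weight p k m x0 = weight p k n y / weight p k n x0"
    using add[of m n] add[OF assms, of m] by (simp add: add.commute)
  then show ?thesis by (simp add: mass_def m_def Let_def)
qed

lemma mass_pos: "0 < mass k y"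
proof -
  obtain n where "up k n y = x0" using up_eventually_x0 by blast
  then show ?thesis by (simp add: mass_eq spine_mass_pos weight_pos)
qed

lemma mass_par: "mass k y = edge p k y * mass (k - 1) (par k y)"
proof -
  obtain n where n: "up (k - 1) n (par k y) = x0" using up_eventually_x0 by blast
  then have "mass k y = spine_mass k * (weight p k (Suc n) y / weight p k (Suc n) x0)"
    by (intro mass_eq) simp
  also have "\<dots> = edge p k y * (spine_mass (k - 1) * (weight p (k - 1) n (par k y) / weight p (k - 1) n x0))"
    using spine_mass_rec[of k] edge_pos[of k x0] by (simp add: par_x0)
  finally show ?thesis by (simp add: mass_eq[OF n])
qed

lemma mass_up: "mass k y = weight p k n y * mass (k - int n) (up k n y)"
proof (induction n arbitrary: k y)
  case (Suc n)
  show ?case using mass_par[of k y] Suc[of "k - 1" "par k y"] by (simp add: algebra_simps)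
qed simp

lemma sum_mass_children:
  assumes "z \<in> net (k - 1)"
  shows "(\<Sum>y\<in>children k z. mass k y) = mass (k - 1) z"
proof -
  have "(\<Sum>y\<in>children k z. mass k y) = (\<Sum>y\<in>children k z. edge p k y * mass (k - 1) z)"
    by (intro sum.cong) (auto simp: children_def mass_par[of k])
  then show ?thesis using sum_edge[OF assms] by (simp flip: sum_distrib_right)
qed

text \<open>Below the first common ancestor both branches consist of edges of weight
  \<open>p\<close>, by \<open>edge_eq_p\<close>, except possibly for the topmost edge, which costs a
  factor of at most \<open>1 / p\<close>.\<close>

lemma mass_neighbour:
  assumes d: "dist y y' \<le> 6 * sc k"
  shows "mass k y \<le> mass k y' / p"
proof -
  have "\<exists>n. up k n y = up k n y'"
  proof -
    obtain m m' where "up k m y = x0" "up k m' y' = x0" using up_eventually_x0 by blast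
    then have "up k (m + m') y = up k (m' + m) y'" by (simp only: up_add up_x0)
    then show ?thesis by (metis add.commute)
  qed
  define n where "n = (LEAST n. up k n y = up k n y')"
  have n: "up k n y = up k n y'" unfolding n_def using \<open>\<exists>n. _\<close> by (rule LeastI_ex)
  have less: "up k i y \<noteq> up k i y'" if "i < n" for i
    using that not_less_Least unfolding n_def by blast
  have eq: "weight p k i y = p ^ i" "weight p k i y' = p ^ i" if "i < n" for i
  proof -
    have d': "dist y' y \<le> 6 * sc k" using d by (simp add: dist_commute)
    have "weight p k i y = p ^ i \<and> weight p k i y' = p ^ i" using that
    proof (induction i)
      case (Suc i)
      have "par (k - int i) (up k i y) \<noteq> par (k - int i) (up k i y')"
        using less[OF Suc.prems] unfolding up_Suc_right .
      note ne = this this[symmetric]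
      show ?case unfolding weight_Suc_right
        using Suc edge_eq_p[OF d ne(1)] edge_eq_p[OF d' ne(2)] by simp
    qed simp
    then show "weight p k i y = p ^ i" "weight p k i y' = p ^ i" by auto
  qed
  have "weight p k n y \<le> weight p k n y' / p"
  proof (cases n)
    case 0
    then show ?thesis using p_le_half p_pos by (simp add: field_simps)
  next
    case (Suc i)
    have "weight p k n y \<le> p ^ i"
      unfolding Suc weight_Suc_right using eq(1)[of i] Suc edge_le_1 p_pos by (simp add: mult_left_le)
    moreover have "p * p ^ i \<le> weight p k n y'"
      unfolding Suc weight_Suc_right using eq(2)[of i] Suc edge_ge p_pos by (simp add: mult.commute)
    ultimately have "p * weight p k n y \<le> weight p k n y'"
      using mult_left_mono[of "weight p k n y" "p ^ i" p] p_pos by linarith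
    then show ?thesis using p_pos by (simp add: field_simps)
  qed
  then show ?thesis
    using mult_right_mono[OF _ less_imp_le[OF mass_pos]]
    unfolding mass_up[of k y n] mass_up[of k y' n] n by fastforce
qed

end

section \<open>The law of a random path\<close>

lemma (in net_tree) countable_net: "countable (net k)"
proof -
  have "net k = (\<Union>n. net k \<inter> cball x0 (real n))"
  proof (intro equalityI subsetI)
    fix y assume "y \<in> net k"
    moreover obtain n where "dist x0 y \<le> real n" using real_arch_simple by blast
    ultimately show "y \<in> (\<Union>n. net k \<inter> cball x0 (real n))" by auto
  qed auto
  also have "countable \<dots>" by (rule countable_UN) (auto intro: countable_finite[OF finite_net])
  finally show ?thesis .
qed

context weighted_net_tree
begin

text \<open>A node is stored with the level of its children, hence the shift.\<close>

definition nodes :: "(int \<times> 'a) set" where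
  "nodes = {(k, z). z \<in> net (k - 1)}"

definition child_law :: "int \<times> 'a \<Rightarrow> 'a measure" where
  "child_law = (\<lambda>(k, z). point_measure (children k z) (\<lambda>y. ennreal (edge p k y)))"

text \<open>A sample is a start on level 0 together with a child chosen at every node independently;
  \<open>walk\<close> follows these choices. The first factor may have infinite total mass.\<close>

definition paths :: "('a \<times> (int \<times> 'a \<Rightarrow> 'a)) measure" where
  "paths = point_measure (net 0) (\<lambda>i. ennreal (mass 0 i)) \<Otimes>\<^sub>M PiM nodes child_law"

lemma emeasure_child_law:
  "y \<in> children k z \<Longrightarrow> emeasure (child_law (k, z)) {y} = ennreal (edge p k y)"
  by (simp add: child_law_def emeasure_point_measure_finite finite_children)

lemma prob_space_child_law:
  assumes "i \<in> nodes"
  shows "prob_space (child_law i)"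
proof
  obtain k z where i: "i = (k, z)" "z \<in> net (k - 1)" using assms by (auto simp: nodes_def)
  have "emeasure (child_law i) (space (child_law i)) = (\<Sum>y\<in>children k z. ennreal (edge p k y))"
    by (simp add: i child_law_def space_point_measure emeasure_point_measure_finite finite_children)
  also have "\<dots> = ennreal (\<Sum>y\<in>children k z. edge p k y)"
    by (intro sum_ennreal less_imp_le edge_pos)
  finally show "emeasure (child_law i) (space (child_law i)) = 1" using sum_edge i(2) by simp
qed

lemma prob_space_PiM_child_law: "prob_space (PiM nodes child_law)"
  by (intro prob_space_PiM prob_space_child_law)

lemma space_paths: "space paths = net 0 \<times> (\<Pi>\<^sub>E i\<in>nodes. children (fst i) (snd i))"
  by (simp add: paths_def space_pair_measure space_PiM space_point_measure child_law_def case_prod_beta)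

fun walk :: "nat \<Rightarrow> 'a \<times> (int \<times> 'a \<Rightarrow> 'a) \<Rightarrow> 'a" where
  "walk 0 w = fst w"
| "walk (Suc n) w = snd w (int (Suc n), walk n w)"

lemma walk_Suc_in_children:
  assumes "w \<in> space paths" "walk n w \<in> net (int n)"
  shows "walk (Suc n) w \<in> children (int (Suc n)) (walk n w)"
proof -
  have "snd w \<in> (\<Pi>\<^sub>E i\<in>nodes. children (fst i) (snd i))"
    using assms(1) unfolding space_paths by (simp only: mem_Times_iff)
  moreover have "(int (Suc n), walk n w) \<in> nodes" using assms(2) by (simp add: nodes_def)
  ultimately have "snd w (int (Suc n), walk n w) \<in>
      children (fst (int (Suc n), walk n w)) (snd (int (Suc n), walk n w))"
    by (rule PiE_mem)
  then show ?thesis by simp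
qed

lemma walk_in_net: "w \<in> space paths \<Longrightarrow> walk n w \<in> net (int n)"
proof (induction n)
  case (Suc n)
  then have "walk (Suc n) w \<in> children (int (Suc n)) (walk n w)"
    using walk_Suc_in_children by blast
  then show ?case by (simp only: children_def mem_Collect_eq)
qed (auto simp: space_paths)

lemma par_walk:
  assumes "w \<in> space paths"
  shows "par (int (Suc n)) (walk (Suc n) w) = walk n w"
  using walk_Suc_in_children[OF assms walk_in_net[OF assms]]
  by (simp only: children_def mem_Collect_eq)

text \<open>The tree determines all ancestors of \<open>y\<close>, so reaching \<open>y\<close>
  prescribes the start and finitely many coordinates.\<close>

lemma walk_eq_iff:
  assumes "w \<in> space paths"
  shows "walk n w = y \<longleftrightarrow> fst w = up (int n) n y \<and>
    (\<forall>i<n. snd w (int n - int i, up (int n) (Suc i) y) = up (int n) i y)"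
proof (induction n arbitrary: y)
  case (Suc n)
  have "walk (Suc n) w = y \<longleftrightarrow>
      walk n w = par (int (Suc n)) y \<and> snd w (int (Suc n), par (int (Suc n)) y) = y"
    using par_walk[OF assms, of n] by auto
  also have "walk n w = par (int (Suc n)) y \<longleftrightarrow> fst w = up (int (Suc n)) (Suc n) y \<and>
    (\<forall>i<n. snd w (int (Suc n) - int (Suc i), up (int (Suc n)) (Suc (Suc i)) y)
       = up (int (Suc n)) (Suc i) y)"
    unfolding Suc.IH by simp
  finally show ?case unfolding All_less_Suc2 by auto
qed auto

lemma weight_prod: "weight p k n y = (\<Prod>i<n. edge p (k - int i) (up k i y))"
  by (induction n) (simp_all only: weight.simps(1) weight_Suc_right prod.lessThan_Suc lessThan_0 prod.empty)

text \<open>The event is a cylinder: its measure is the mass of the ancestor on level 0 times the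
  product of the edges down to \<open>y\<close>, which is the mass of \<open>y\<close> by
  \<open>mass_up\<close>.\<close>

lemma emeasure_walk:
  assumes y: "y \<in> net (int n)"
  shows "{w \<in> space paths. walk n w = y} \<in> sets paths"
    and "emeasure paths {w \<in> space paths. walk n w = y} = ennreal (mass (int n) y)"
proof -
  interpret C: prob_space "PiM nodes child_law" by (rule prob_space_PiM_child_law)
  \<comment> \<open>\<open>f i\<close> is the coordinate that must take the value
    \<open>up (int n) i y\<close>. \<open>?X\<close> recovers \<open>i\<close> from the level, so
    that it is a function of the coordinate.\<close>
  define f where "f i = (int n - int i, up (int n) (Suc i) y)" for i
  let ?X = "\<lambda>(k, z::'a). {up (int n) (nat (int n - k)) y}"
  let ?E = "prod_emb nodes child_law (f ` {..<n}) (Pi\<^sub>E (f ` {..<n}) ?X)"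
  have child: "up (int n) i y \<in> children (fst (f i)) (snd (f i))" for i
    unfolding f_def fst_conv snd_conv children_def up_Suc_right using up_in_net[OF y] by blast
  have nodes: "f i \<in> nodes" for i
    using par_props(1)[of "int n - int i" "up (int n) i y"]
    unfolding f_def nodes_def up_Suc_right by simp
  have X: "?X (f i) = {up (int n) i y}" for i by (simp add: f_def)
  have sets: "?X j \<in> sets (child_law j)" if "j \<in> f ` {..<n}" for j
    using that child X by (auto simp: child_law_def sets_point_measure case_prod_beta)
  have E: "{w \<in> space paths. walk n w = y} = {up (int n) n y} \<times> ?E"
  proof -
    have "w \<in> {up (int n) n y} \<times> ?E \<longleftrightarrow> w \<in> space paths \<and> walk n w = y" for w
    proof (cases w)
      case (Pair a \<omega>)
      have "up (int n) n y \<in> net 0" using up_in_net[OF y, of n] by simp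
      moreover have "up (int n) (nat (int n - fst (f i))) y = up (int n) i y" for i
        by (simp add: f_def)
      then have "\<omega> \<in> ?E \<longleftrightarrow> \<omega> \<in> (\<Pi>\<^sub>E i\<in>nodes. children (fst i) (snd i)) \<and>
        (\<forall>i<n. \<omega> (f i) = up (int n) i y)"
        using nodes
        by (simp add: prod_emb_iff PiE_iff X child_law_def space_point_measure case_prod_beta
            extensional_def del: split_paired_All) auto
      ultimately show ?thesis using walk_eq_iff[of w n y]
        by (auto simp: Pair space_paths f_def)
    qed
    then show ?thesis by blast
  qed
  have E_sets: "?E \<in> sets (PiM nodes child_law)"
    using nodes sets by (intro sets_PiM_I) auto
  have top: "{up (int n) n y} \<in> sets (point_measure (net 0) (\<lambda>i. ennreal (mass 0 i)))"
    using up_in_net[OF y, of n] by (simp add: sets_point_measure)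
  show "{w \<in> space paths. walk n w = y} \<in> sets paths"
    unfolding E unfolding paths_def using top E_sets by (rule pair_measureI)
  have "emeasure paths {w \<in> space paths. walk n w = y} =
      emeasure (point_measure (net 0) (\<lambda>i. ennreal (mass 0 i))) {up (int n) n y} *
      emeasure (PiM nodes child_law) ?E"
    unfolding E unfolding paths_def using top E_sets by (rule C.emeasure_pair_measure_Times)
  also have "emeasure (point_measure (net 0) (\<lambda>i. ennreal (mass 0 i))) {up (int n) n y} =
      ennreal (mass 0 (up (int n) n y))"
    using up_in_net[OF y, of n] by (subst emeasure_point_measure_finite2) auto
  also have "emeasure (PiM nodes child_law) ?E = (\<Prod>j\<in>f ` {..<n}. emeasure (child_law j) (?X j))"
    using nodes sets by (intro emeasure_PiM_emb prob_space_child_law) auto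
  also have "\<dots> = (\<Prod>i<n. emeasure (child_law (f i)) (?X (f i)))"
    by (subst prod.reindex) (auto simp: inj_on_def f_def)
  also have "\<dots> = (\<Prod>i<n. ennreal (edge p (int n - int i) (up (int n) i y)))"
    unfolding X using emeasure_child_law[OF child] by (intro prod.cong) (auto simp: f_def)
  also have "\<dots> = ennreal (weight p (int n) n y)"
    unfolding weight_prod using edge_pos by (intro prod_ennreal) (simp add: less_imp_le)
  finally show "emeasure paths {w \<in> space paths. walk n w = y} = ennreal (mass (int n) y)"
    unfolding mass_up[of "int n" y n] using mass_pos weight_pos
    by (simp add: ennreal_mult less_imp_le mult.commute)
qed

text \<open>Levels coarser than 0 are filled in with the ancestors of the start, so that balls of
  every size can be treated.\<close>

definition node_at :: "int \<Rightarrow> 'a \<times> (int \<times> 'a \<Rightarrow> 'a) \<Rightarrow> 'a" where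
  "node_at k w = (if 0 \<le> k then walk (nat k) w else up 0 (nat (- k)) (fst w))"

lemma node_at_in_net:
  assumes "w \<in> space paths"
  shows "node_at k w \<in> net k"
proof (cases "0 \<le> k")
  case False
  have "fst w \<in> net 0" using assms by (auto simp: space_paths)
  then show ?thesis using up_in_net[of "fst w" 0 "nat (- k)"] False by (simp add: node_at_def)
qed (use walk_in_net[OF assms, of "nat k"] in \<open>simp add: node_at_def\<close>)

lemma par_node_at:
  assumes "w \<in> space paths"
  shows "par k (node_at k w) = node_at (k - 1) w"
proof (cases "1 \<le> k")
  case True
  then have "nat k = Suc (nat (k - 1))" by simp
  then show ?thesis using True par_walk[OF assms, of "nat (k - 1)"]
    by (simp add: node_at_def del: walk.simps)
next
  case False
  then have n: "nat (- (k - 1)) = Suc (nat (- k))" "0 - int (nat (- k)) = k" by simp_all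
  show ?thesis using False unfolding node_at_def n(1) up_Suc_right n(2) by (cases "k = 0") auto
qed

lemma up_node_at:
  assumes "w \<in> space paths"
  shows "up k n (node_at k w) = node_at (k - int n) w"
  by (induction n arbitrary: k) (simp_all add: par_node_at[OF assms] algebra_simps)

text \<open>On a coarse level the event says that the start descends from \<open>y\<close>; by
  \<open>sum_desc\<close> the masses of these starts add up to that of \<open>y\<close>.\<close>

lemma emeasure_node_at:
  assumes y: "y \<in> net k"
  shows "{w \<in> space paths. node_at k w = y} \<in> sets paths" (is ?A)
    and "emeasure paths {w \<in> space paths. node_at k w = y} = ennreal (mass k y)" (is ?B)
proof -
  interpret C: prob_space "PiM nodes child_law" by (rule prob_space_PiM_child_law)
  have "?A \<and> ?B"
  proof (cases "0 \<le> k")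
    case True
    then show ?thesis using emeasure_walk[of y "nat k"] y by (simp add: node_at_def)
  next
    case False
    define n where "n = nat (- k)"
    have k: "k = 0 - int n" using False by (simp add: n_def)
    have E: "{w \<in> space paths. node_at k w = y} = desc 0 n y \<times> space (PiM nodes child_law)"
      using False by (auto simp: node_at_def desc_def n_def paths_def space_pair_measure space_point_measure)
    have d: "desc 0 n y \<in> sets (point_measure (net 0) (\<lambda>i. ennreal (mass 0 i)))"
      by (auto simp: sets_point_measure desc_def)
    have "emeasure paths {w \<in> space paths. node_at k w = y} =
        emeasure (point_measure (net 0) (\<lambda>i. ennreal (mass 0 i))) (desc 0 n y) * 1"
      unfolding E unfolding paths_def using d C.emeasure_space_1
      by (subst C.emeasure_pair_measure_Times) auto
    also have "\<dots> = (\<Sum>i\<in>desc 0 n y. ennreal (mass 0 i))"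
      using finite_desc[of 0 n y] d by (simp add: emeasure_point_measure_finite2 sets_point_measure)
    also have "\<dots> = ennreal (\<Sum>i\<in>desc 0 n y. mass 0 i)"
      by (intro sum_ennreal less_imp_le mass_pos)
    also have "(\<Sum>i\<in>desc 0 n y. mass 0 i) = mass (0 - int n) y"
      using y k by (intro sum_desc sum_mass_children) auto
    finally have ?B using k by simp
    moreover have ?A unfolding E unfolding paths_def using d by (intro pair_measureI) auto
    ultimately show ?thesis by simp
  qed
  then show ?A ?B by auto
qed

section \<open>Endpoints of paths and the measure \<mu>\<close>

definition endpoint :: "'a \<times> (int \<times> 'a \<Rightarrow> 'a) \<Rightarrow> 'a" where
  "endpoint w = lim (\<lambda>n. node_at (int n) w)"

lemma dist_node_at_le:
  assumes "w \<in> space paths" "j \<le> k"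
  shows "dist (node_at j w) (node_at k w) \<le> 2 * sc j"
  using dist_up_le[of k "nat (k - j)" "node_at k w"] up_node_at[OF assms(1), of k "nat (k - j)"] assms(2)
  by simp

text \<open>Completeness enters here: all nodes of a path from level \<open>k\<close> on are within
  \<open>4 * sc k\<close> of each other.\<close>

lemma node_at_tendsto:
  assumes w: "w \<in> space paths"
  shows "(\<lambda>n. node_at (int n) w) \<longlonglongrightarrow> endpoint w"
proof -
  have "Cauchy (\<lambda>n. node_at (int n) w)"
  proof (rule metric_CauchyI)
    fix r :: real assume "0 < r"
    then obtain k where k: "sc k \<le> r / 5" using ex_scale[of "r / 5"] by auto
    have "dist (node_at (int m) w) (node_at (int n) w) < r" if "nat k \<le> m" "nat k \<le> n" for m n
    proof -
      have "dist (node_at (int m) w) (node_at (int n) w) \<le>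
          dist (node_at (int (nat k)) w) (node_at (int m) w) +
          dist (node_at (int (nat k)) w) (node_at (int n) w)"
        by (rule dist_triangle3)
      also have "\<dots> \<le> 4 * sc (int (nat k))"
        using dist_node_at_le[OF w, of "int (nat k)" "int m"] dist_node_at_le[OF w, of "int (nat k)" "int n"]
          that by linarith
      also have "sc (int (nat k)) \<le> sc k" by (rule sc_antimono) simp
      finally show ?thesis using k \<open>0 < r\<close> by linarith
    qed
    then show "\<exists>M. \<forall>m\<ge>M. \<forall>n\<ge>M. dist (node_at (int m) w) (node_at (int n) w) < r" by blast
  qed
  then show ?thesis unfolding endpoint_def using Cauchy_convergent convergent_LIMSEQ_iff by blast
qed

lemma dist_node_at_endpoint:
  assumes w: "w \<in> space paths"
  shows "dist (node_at k w) (endpoint w) \<le> 2 * sc k"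
proof (rule LIMSEQ_le_const2)
  show "(\<lambda>n. dist (node_at k w) (node_at (int n) w)) \<longlonglongrightarrow> dist (node_at k w) (endpoint w)"
    by (intro tendsto_intros node_at_tendsto w)
  show "\<exists>m. \<forall>n\<ge>m. dist (node_at k w) (node_at (int n) w) \<le> 2 * sc k"
    using dist_node_at_le[OF w] by (intro exI[of _ "nat k"]) auto
qed

text \<open>The values lie in a countable net, so every preimage is a countable union of the events
  of \<open>emeasure_node_at\<close>.\<close>

lemma node_at_measurable: "node_at k \<in> borel_measurable paths"
proof (rule measurableI)
  fix A :: "'a set"
  have "node_at k -` A \<inter> space paths = (\<Union>y\<in>net k \<inter> A. {w \<in> space paths. node_at k w = y})"
    using node_at_in_net by auto
  also have "\<dots> \<in> sets paths"
    using emeasure_node_at(1) countable_net by (intro sets.countable_UN') auto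
  finally show "node_at k -` A \<inter> space paths \<in> sets paths" .
qed simp

lemma endpoint_measurable: "endpoint \<in> borel_measurable paths"
  using node_at_measurable node_at_tendsto by (rule borel_measurable_LIMSEQ_metric)

definition \<mu> :: "'a measure" where
  "\<mu> = distr paths borel endpoint"

lemma sets_\<mu> [simp]: "sets \<mu> = sets borel" and space_\<mu> [simp]: "space \<mu> = UNIV"
  by (simp_all add: \<mu>_def)

text \<open>Every path through \<open>y\<close> on level \<open>k\<close> ends within
  \<open>2 * sc k\<close> of \<open>y\<close>, hence in \<open>B\<close>.\<close>

lemma \<mu>_ge_mass:
  assumes y: "y \<in> net k" and B: "B \<in> sets borel" "cball y (2 * sc k) \<subseteq> B"
  shows "ennreal (mass k y) \<le> emeasure \<mu> B"
proof -
  have "ennreal (mass k y) = emeasure paths {w \<in> space paths. node_at k w = y}"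
    by (rule emeasure_node_at(2)[OF y, symmetric])
  also have "\<dots> \<le> emeasure paths (endpoint -` B \<inter> space paths)"
  proof (rule emeasure_mono)
    show "{w \<in> space paths. node_at k w = y} \<subseteq> endpoint -` B \<inter> space paths"
      using dist_node_at_endpoint B(2) by fastforce
  qed (rule measurable_sets[OF endpoint_measurable B(1)])
  finally show ?thesis unfolding \<mu>_def using B(1) by (simp add: emeasure_distr endpoint_measurable)
qed

lemma \<mu>_le_sum_mass:
  assumes S: "finite S" "S \<subseteq> net k" and B: "B \<in> sets borel"
    and meet: "\<And>z v. z \<in> net k \<Longrightarrow> v \<in> B \<Longrightarrow> dist z v \<le> 2 * sc k \<Longrightarrow> z \<in> S"
  shows "emeasure \<mu> B \<le> ennreal (\<Sum>z\<in>S. mass k z)"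
proof -
  have "emeasure \<mu> B = emeasure paths (endpoint -` B \<inter> space paths)"
    unfolding \<mu>_def using B by (simp add: emeasure_distr endpoint_measurable)
  also have "\<dots> \<le> emeasure paths (\<Union>z\<in>S. {w \<in> space paths. node_at k w = z})"
  proof (rule emeasure_mono)
    show "endpoint -` B \<inter> space paths \<subseteq> (\<Union>z\<in>S. {w \<in> space paths. node_at k w = z})"
      using dist_node_at_endpoint node_at_in_net meet by fastforce
    show "(\<Union>z\<in>S. {w \<in> space paths. node_at k w = z}) \<in> sets paths"
      using S emeasure_node_at(1) by (intro sets.finite_UN) auto
  qed
  also have "\<dots> \<le> (\<Sum>z\<in>S. emeasure paths {w \<in> space paths. node_at k w = z})"
    using S emeasure_node_at(1) by (intro emeasure_subadditive_finite) auto
  also have "\<dots> = (\<Sum>z\<in>S. ennreal (mass k z))"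
    using S by (intro sum.cong emeasure_node_at(2)) auto
  also have "\<dots> = ennreal (\<Sum>z\<in>S. mass k z)"
    by (intro sum_ennreal less_imp_le mass_pos)
  finally show ?thesis .
qed

text \<open>Paths that end in the ball pass level \<open>j\<close> within \<open>3 * sc j\<close> of
  \<open>x\<close>. The number of such nodes is bounded, and all are within \<open>6 * sc j\<close>
  of \<open>z\<close>, the distance allowed in \<open>mass_neighbour\<close>.\<close>

lemma \<mu>_cball_le:
  assumes z: "z \<in> net j" "dist z x \<le> 3 * sc j" and R: "R \<le> sc j"
  shows "emeasure \<mu> (cball x R) \<le> ennreal (K * 3 powr e / p * mass j z)"
proof -
  define S where "S = net j \<inter> cball x (3 * sc j)"
  have "emeasure \<mu> (cball x R) \<le> ennreal (\<Sum>v\<in>S. mass j v)"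
  proof (rule \<mu>_le_sum_mass)
    fix v u assume "v \<in> net j" "u \<in> cball x R" "dist v u \<le> 2 * sc j"
    then show "v \<in> S" using R dist_triangle[of x v u] by (simp add: S_def dist_commute)
  qed (auto simp: S_def finite_net)
  also have "(\<Sum>v\<in>S. mass j v) \<le> of_nat (card S) * (mass j z / p)"
  proof (rule sum_bounded_above)
    fix v assume "v \<in> S"
    then have "dist v z \<le> 6 * sc j"
      using z(2) dist_triangle[of v z x] by (simp add: S_def dist_commute)
    then show "mass j v \<le> mass j z / p" by (rule mass_neighbour)
  qed
  also have "\<dots> \<le> (K * 3 powr e) * (mass j z / p)"
    unfolding S_def using card_net[of 3 j x] p_pos mass_pos[of j z]
    by (intro mult_right_mono) auto
  finally show ?thesis by (simp add: ennreal_leI)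
qed

end

section \<open>Admissible exponents\<close>

context net_tree
begin

text \<open>The exponents admissible for \<mu>, expressed by the tree alone (see
  \<open>exponents_iff\<close>): \<open>n\<close> generations stand for a ratio \<open>R / r\<close>
  of order \<open>(1 / \<delta>) ^ n\<close>. This form allows different \<open>p\<close> to be
  compared edge by edge.\<close>

definition exponents :: "real \<Rightarrow> real set" where
  "exponents p = {\<alpha>. 0 \<le> \<alpha> \<and> (\<exists>c>0. \<forall>k n. \<forall>y\<in>net k. c * (\<delta> powr \<alpha>) ^ n \<le> weight p k n y)}"

lemma exponents_mono:
  assumes "\<alpha> \<in> exponents p" "\<alpha> \<le> \<beta>"
  shows "\<beta> \<in> exponents p"
proof -
  obtain c where c: "0 < c" "\<And>k n y. y \<in> net k \<Longrightarrow> c * (\<delta> powr \<alpha>) ^ n \<le> weight p k n y"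
    using assms(1) unfolding exponents_def by blast
  have "\<delta> powr \<beta> \<le> \<delta> powr \<alpha>" using assms(2) delta_pos delta_le by (intro powr_mono') auto
  then have "c * (\<delta> powr \<beta>) ^ n \<le> c * (\<delta> powr \<alpha>) ^ n" for n
    using c(1) by (intro mult_left_mono power_mono) auto
  then have "\<forall>k n. \<forall>y\<in>net k. c * (\<delta> powr \<beta>) ^ n \<le> weight p k n y" using c(2) by (meson order_trans)
  then show ?thesis using assms c(1) by (auto simp: exponents_def)
qed

text \<open>One factor \<delta> is lost in rounding \<open>r\<close> down to a scale, another in
  passing to a scale strictly above \<open>R\<close>.\<close>

lemma scale_ratio:
  assumes r: "0 < r" "r < R"
  obtains j k n where "j = k - int n" "sc k \<le> r" "R < sc j"
    "\<And>\<alpha>. 0 \<le> \<alpha> \<Longrightarrow> (\<delta>\<^sup>2 * (r / R)) powr \<alpha> \<le> (\<delta> powr \<alpha>) ^ n"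
proof -
  obtain k where k: "sc k \<le> r" "r < sc (k - 1)" using ex_scale r(1) by blast
  obtain i where i: "sc i \<le> R" "R < sc (i - 1)" using ex_scale[of R] r by (metis less_trans)
  define n where "n = nat (k - (i - 1))"
  have "sc k < sc (i - 1)" using k i r by linarith
  then have n: "i - 1 = k - int n" unfolding sc_less_iff by (simp add: n_def)
  have "\<delta>\<^sup>2 * (r / R) \<le> \<delta> ^ n"
  proof -
    have "\<delta> * r \<le> sc k" using k(2) sc_Suc[of k] delta_pos by (simp add: mult_left_mono)
    also have "sc k = \<delta> ^ n * sc (i - 1)" using sc_diff_nat[of k n] n by simp
    finally have "\<delta> * (\<delta> * r) \<le> \<delta> * (\<delta> ^ n * sc (i - 1))" using delta_pos by (simp add: mult_left_mono)
    also have "\<dots> = \<delta> ^ n * sc i" using sc_Suc[of i] by simp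
    also have "\<dots> \<le> \<delta> ^ n * R" using i(1) delta_pos by simp
    finally show ?thesis using r by (simp add: field_simps power2_eq_square)
  qed
  then have "(\<delta>\<^sup>2 * (r / R)) powr \<alpha> \<le> (\<delta> powr \<alpha>) ^ n" if "0 \<le> \<alpha>" for \<alpha>
  proof -
    have "(\<delta>\<^sup>2 * (r / R)) powr \<alpha> \<le> (\<delta> ^ n) powr \<alpha>"
      using \<open>\<delta>\<^sup>2 * (r / R) \<le> \<delta> ^ n\<close> that r by (intro powr_mono2) auto
    also have "\<dots> = (\<delta> powr \<alpha>) ^ n"
      using delta_pos by (simp flip: powr_realpow add: powr_powr mult.commute)
    finally show ?thesis .
  qed
  with n k(1) i(2) show ?thesis by (intro that) auto
qed

text \<open>The weights of the descendants of a node sum to one and are bounded below, which bounds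
  their number. Net points of a scale below \<open>r\<close> cover the ball, and those required
  descend from boundedly many nodes.\<close>

lemma covering_number_le:
  assumes weighted: "weighted_net_tree \<delta> net x0 K e p" and \<alpha>: "\<alpha> \<in> exponents p"
  shows "\<exists>C::real. 0 < C \<and> (\<forall>(x::'a) r R. 0 < r \<and> r < R \<longrightarrow>
           ereal_of_enat (covering_number x R r) \<le> ereal (C * (R / r) powr \<alpha>))"
proof -
  interpret weighted_net_tree \<delta> net x0 K e p by (rule weighted)
  obtain c where c: "0 < c" "\<And>k n y. y \<in> net k \<Longrightarrow> c * (\<delta> powr \<alpha>) ^ n \<le> weight p k n y"
    and "0 \<le> \<alpha>" using \<alpha> unfolding exponents_def by blast
  define C where "C = K * 4 powr e / (c * (\<delta>\<^sup>2) powr \<alpha>)"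
  have "0 < C" using c(1) K_ge_1 delta_pos by (simp add: C_def)
  moreover have "ereal_of_enat (covering_number x R r) \<le> ereal (C * (R / r) powr \<alpha>)"
    if r: "0 < r" "r < R" for x :: 'a and r R
  proof -
    obtain j k n where j: "j = k - int n" and k: "sc k \<le> r" "R < sc j"
      and ratio: "(\<delta>\<^sup>2 * (r / R)) powr \<alpha> \<le> (\<delta> powr \<alpha>) ^ n"
      using scale_ratio[OF r] \<open>0 \<le> \<alpha>\<close> by metis
    \<comment> \<open>The radius bounds \<open>R + sc k + 2 * sc j\<close>, where \<open>R\<close>
      and \<open>sc k\<close> are below \<open>sc j\<close>.\<close>
    define S where "S = net j \<inter> cball x (4 * sc j)"
    define F where "F = (\<Union>z\<in>S. desc k n z)"
    have S: "finite S" "card S \<le> K * 4 powr e"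
      unfolding S_def using finite_net card_net[of 4 j x] by auto
    have F: "finite F" unfolding F_def using S finite_desc by auto
    have "cball x R \<subseteq> (\<Union>y\<in>F. cball y r)"
    proof
      fix v assume v: "v \<in> cball x R"
      obtain y where y: "y \<in> net k" "dist v y < sc k" using dense by blast
      define z where "z = up k n y"
      have "dist x z \<le> dist x v + dist v z" "dist v z \<le> dist v y + dist z y"
        by (rule dist_triangle, rule dist_triangle2)
      then have "dist x z \<le> R + sc k + 2 * sc j"
        using v y(2) dist_up_le[of k n y] by (simp add: z_def j)
      then have "z \<in> S" using up_in_net[OF y(1), of n] k r by (simp add: S_def z_def j)
      then have "y \<in> F" using y(1) by (auto simp: F_def desc_def z_def)
      then show "v \<in> (\<Union>y\<in>F. cball y r)"
        using y(2) k(1) by (auto simp: dist_commute intro!: bexI[of _ y])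
    qed
    then have "covering_number x R r \<le> enat (card F)"
      unfolding covering_number_def using F by (intro Inf_lower) auto
    then have "ereal_of_enat (covering_number x R r) \<le> ereal_of_enat (enat (card F))"
      by (simp only: ereal_of_enat_le_iff)
    also have "\<dots> = ereal (card F)" by simp
    also have "real (card F) \<le> C * (R / r) powr \<alpha>"
    proof -
      have desc: "card (desc k n z) \<le> 1 / (c * (\<delta> powr \<alpha>) ^ n)" if "z \<in> S" for z
      proof -
        have "card (desc k n z) * (c * (\<delta> powr \<alpha>) ^ n) \<le> (\<Sum>y\<in>desc k n z. weight p k n y)"
          using c(2) by (intro sum_bounded_below) (auto simp: desc_def)
        also have "\<dots> = 1" using that j by (intro sum_weight_desc) (auto simp: S_def)
        finally show ?thesis using c(1) delta_pos by (simp add: field_simps)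
      qed
      have "card F \<le> (\<Sum>z\<in>S. card (desc k n z))"
        unfolding F_def using S(1) by (rule card_UN_le)
      then have "real (card F) \<le> (\<Sum>z\<in>S. real (card (desc k n z)))"
        by (simp flip: of_nat_sum)
      also have "\<dots> \<le> card S * (1 / (c * (\<delta> powr \<alpha>) ^ n))"
        using desc by (rule sum_bounded_above)
      also have "\<dots> \<le> (K * 4 powr e) * (1 / (c * (\<delta> powr \<alpha>) ^ n))"
        using S(2) c(1) by (intro mult_right_mono) auto
      also have "\<dots> \<le> (K * 4 powr e) * (1 / (c * (\<delta>\<^sup>2 * (r / R)) powr \<alpha>))"
        using ratio c(1) K_ge_1 delta_pos r
        by (intro mult_left_mono divide_left_mono mult_pos_pos) auto
      also have "\<dots> = C * (R / r) powr \<alpha>"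
        unfolding C_def using r delta_pos
        by (simp add: powr_mult powr_divide field_simps)
      finally show ?thesis .
    qed
    finally show ?thesis by simp
  qed
  ultimately show ?thesis by blast
qed

section \<open>Dependence of the admissible exponents on the parameter\<close>

lemma weight_lipschitz:
  assumes pos: "0 < t" "0 < t'" and small: "branching * \<delta> powr t \<le> 1 / 2"
      "branching * \<delta> powr t' \<le> 1 / 2"
  shows "weight (\<delta> powr t) k n y * (\<delta> powr \<bar>t - t'\<bar>) ^ n \<le> weight (\<delta> powr t') k n y"
proof -
  interpret T: weighted_net_tree \<delta> net x0 K e "\<delta> powr t"
    using small delta_pos by unfold_locales auto
  interpret T': weighted_net_tree \<delta> net x0 K e "\<delta> powr t'"
    using small delta_pos by unfold_locales auto
  \<comment> \<open>A weight is a product of \<open>n\<close> edges, so it suffices to lose one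
    factor \<open>\<delta> powr \<bar>t - t'\<bar>\<close> per edge.\<close>
  have edge: "edge (\<delta> powr t) k y * \<delta> powr \<bar>t - t'\<bar> \<le> edge (\<delta> powr t') k y" for k y
  proof (cases "y = cen k (par k y)")
    case True
    define m where "m = real (card (children k (par k y))) - 1"
    have m: "0 \<le> m" "m \<le> branching"
      using card_children_ge_1[OF par_props(1), of k y] card_children_le[of k "par k y"] by (simp_all add: m_def)
    have half: "m * \<delta> powr t \<le> 1 / 2" "m * \<delta> powr t' \<le> 1 / 2"
      using mult_right_mono[OF m(2), of "\<delta> powr t"] mult_right_mono[OF m(2), of "\<delta> powr t'"] small
      by simp_all
    have "(1 - m * \<delta> powr t) * \<delta> powr \<bar>t - t'\<bar> \<le> 1 - m * \<delta> powr t'"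
    proof (cases "t \<le> t'")
      case True
      have "\<delta> powr \<bar>t - t'\<bar> \<le> 1" using delta_pos delta_le by (simp add: powr_le1)
      then have "(1 - m * \<delta> powr t) * \<delta> powr \<bar>t - t'\<bar> \<le> 1 - m * \<delta> powr t"
        using half by (intro mult_left_le) auto
      also have "\<dots> \<le> 1 - m * \<delta> powr t'"
        using m True delta_pos delta_le by (intro diff_left_mono mult_left_mono powr_mono') auto
      finally show ?thesis .
    next
      case False
      \<comment> \<open>With \<open>u = m \<delta>\<^sup>t'\<close> and \<open>a = \<delta>\<^sup>t\<^sup>-\<^sup>t'\<close> the claim reads \<open>a - u a\<^sup>2 \<le> 1 - u\<close>, that is \<open>u (1 + a) \<le> 1\<close>.\<close>
      define a u where "a = \<delta> powr (t - t')" and "u = m * \<delta> powr t'"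
      have a: "0 < a" "a \<le> 1" using delta_pos delta_le False by (simp_all add: a_def powr_le1)
      have u: "m * \<delta> powr t = u * a" by (simp add: u_def a_def powr_diff delta_pos)
      have "u * (1 + a) \<le> 1" using half unfolding u u_def[symmetric] by (simp add: algebra_simps)
      then have "(1 - a) * (u * (1 + a)) \<le> (1 - a) * 1" using a by (intro mult_left_mono) auto
      then have "(1 - u * a) * a \<le> 1 - u" by (simp add: algebra_simps)
      moreover have "\<bar>t - t'\<bar> = t - t'" using False by simp
      ultimately show ?thesis unfolding u u_def[symmetric] by (simp add: a_def)
    qed
    then show ?thesis using True by (simp add: edge_def m_def)
  next
    case False
    have "\<delta> powr t * \<delta> powr \<bar>t - t'\<bar> \<le> \<delta> powr t'"
      unfolding powr_add[symmetric] using delta_pos delta_le by (intro powr_mono') auto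
    then show ?thesis using False by (simp add: edge_def)
  qed
  show ?thesis
  proof (induction n arbitrary: k y)
    case (Suc n)
    have "edge (\<delta> powr t) k y * \<delta> powr \<bar>t - t'\<bar> *
        (weight (\<delta> powr t) (k - 1) n (par k y) * (\<delta> powr \<bar>t - t'\<bar>) ^ n)
      \<le> edge (\<delta> powr t') k y * weight (\<delta> powr t') (k - 1) n (par k y)"
      using edge Suc T.weight_pos T'.edge_pos
      by (intro mult_mono) (auto intro!: mult_nonneg_nonneg simp: less_imp_le)
    then show ?case by (simp add: ac_simps)
  qed simp
qed

lemma exponents_lipschitz:
  assumes pos: "0 < t" "0 < t'" and small: "branching * \<delta> powr t \<le> 1 / 2"
      "branching * \<delta> powr t' \<le> 1 / 2"
    and \<alpha>: "\<alpha> \<in> exponents (\<delta> powr t)"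
  shows "\<alpha> + \<bar>t - t'\<bar> \<in> exponents (\<delta> powr t')"
proof -
  obtain c where c: "0 < c" "\<And>k n y. y \<in> net k \<Longrightarrow> c * (\<delta> powr \<alpha>) ^ n \<le> weight (\<delta> powr t) k n y"
    and "0 \<le> \<alpha>" using \<alpha> unfolding exponents_def by blast
  have "c * (\<delta> powr (\<alpha> + \<bar>t - t'\<bar>)) ^ n \<le> weight (\<delta> powr t') k n y" if "y \<in> net k" for k n y
  proof -
    have "c * (\<delta> powr (\<alpha> + \<bar>t - t'\<bar>)) ^ n = c * (\<delta> powr \<alpha>) ^ n * (\<delta> powr \<bar>t - t'\<bar>) ^ n"
      by (simp add: powr_add power_mult_distrib)
    also have "\<dots> \<le> weight (\<delta> powr t) k n y * (\<delta> powr \<bar>t - t'\<bar>) ^ n"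
      using c(2)[OF that] by (intro mult_right_mono) auto
    also have "\<dots> \<le> weight (\<delta> powr t') k n y" by (rule weight_lipschitz[OF pos small])
    finally show ?thesis .
  qed
  then show ?thesis using c(1) \<open>0 \<le> \<alpha>\<close> by (auto simp: exponents_def)
qed

text \<open>Raising the weights to the power \<open>\<tau> / t\<close> turns the parameter \<open>\<delta>\<^sup>t\<close> into \<open>\<delta>\<^sup>\<tau>\<close>, up to the
  small losses at the central children.\<close>

lemma exponents_power:
  assumes pos: "0 < \<tau>" "\<tau> \<le> t" and small: "branching * \<delta> powr \<tau> \<le> 1 / 2"
    and \<eta>: "\<delta> powr \<eta> \<le> 1 - branching * \<delta> powr \<tau>" "0 \<le> \<eta>"
    and \<alpha>: "\<alpha> \<in> exponents (\<delta> powr t)"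
  shows "\<alpha> * (\<tau> / t) + \<eta> \<in> exponents (\<delta> powr \<tau>)"
proof -
  have small': "branching * \<delta> powr t \<le> 1 / 2"
  proof -
    have "branching * \<delta> powr t \<le> branching * \<delta> powr \<tau>"
      using branching_ge_1 pos delta_pos delta_le by (intro mult_left_mono powr_mono') auto
    then show ?thesis using small by simp
  qed
  interpret T: weighted_net_tree \<delta> net x0 K e "\<delta> powr t"
    using small' delta_pos by unfold_locales auto
  interpret T': weighted_net_tree \<delta> net x0 K e "\<delta> powr \<tau>"
    using small delta_pos by unfold_locales auto
  have \<eta>1: "\<delta> powr \<eta> \<le> 1" using \<eta>(2) delta_pos delta_le by (simp add: powr_le1)
  have edge: "edge (\<delta> powr t) k y powr (\<tau> / t) * \<delta> powr \<eta> \<le> edge (\<delta> powr \<tau>) k y" for k y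
  proof (cases "y = cen k (par k y)")
    case True
    \<comment> \<open>The central edge for \<open>t\<close> is bounded by 1, and the one for \<tau>
      is at least \<open>\<delta> powr \<eta>\<close> by hypothesis.\<close>
    have "edge (\<delta> powr t) k y powr (\<tau> / t) * \<delta> powr \<eta> \<le> 1 * \<delta> powr \<eta>"
      using T.edge_le_1 T.edge_pos pos
      by (intro mult_right_mono powr_le1) (auto simp: less_imp_le)
    also have "\<dots> \<le> edge (\<delta> powr \<tau>) k y"
      using \<eta>(1) edge_central_ge(1)[of "\<delta> powr \<tau>" "par k y" k] par_props(1)[of k y] True
      by (simp add: edge_def)
    finally show ?thesis .
  next
    case False
    then show ?thesis using \<eta>1 pos by (simp add: edge_def powr_powr mult_left_le)
  qed
  have weight: "weight (\<delta> powr t) k n y powr (\<tau> / t) * (\<delta> powr \<eta>) ^ n \<le> weight (\<delta> powr \<tau>) k n y" for k n y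
  proof (induction n arbitrary: k y)
    case (Suc n)
    have "(edge (\<delta> powr t) k y powr (\<tau> / t) * \<delta> powr \<eta>) *
        (weight (\<delta> powr t) (k - 1) n (par k y) powr (\<tau> / t) * (\<delta> powr \<eta>) ^ n)
      \<le> edge (\<delta> powr \<tau>) k y * weight (\<delta> powr \<tau>) (k - 1) n (par k y)"
      using edge Suc T'.edge_pos by (intro mult_mono) (auto simp: less_imp_le)
    then show ?case
      using T.edge_pos T.weight_pos by (simp add: powr_mult less_imp_le ac_simps)
  qed simp
  obtain c where c: "0 < c" "\<And>k n y. y \<in> net k \<Longrightarrow> c * (\<delta> powr \<alpha>) ^ n \<le> weight (\<delta> powr t) k n y"
    and "0 \<le> \<alpha>" using \<alpha> unfolding exponents_def by blast
  have "c powr (\<tau> / t) * (\<delta> powr (\<alpha> * (\<tau> / t) + \<eta>)) ^ n \<le> weight (\<delta> powr \<tau>) k n y"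
    if "y \<in> net k" for k n y
  proof -
    have eq: "((\<delta> powr \<alpha>) ^ n) powr (\<tau> / t) = (\<delta> powr (\<alpha> * (\<tau> / t))) ^ n"
      using delta_pos by (simp flip: powr_realpow add: powr_powr ac_simps)
    have "c powr (\<tau> / t) * (\<delta> powr (\<alpha> * (\<tau> / t) + \<eta>)) ^ n
        = (c * (\<delta> powr \<alpha>) ^ n) powr (\<tau> / t) * (\<delta> powr \<eta>) ^ n"
      unfolding powr_add power_mult_distrib using c(1) by (simp add: powr_mult eq)
    also have "\<dots> \<le> weight (\<delta> powr t) k n y powr (\<tau> / t) * (\<delta> powr \<eta>) ^ n"
      using c(1) c(2)[OF that] pos by (intro mult_right_mono powr_mono2) auto
    also have "\<dots> \<le> weight (\<delta> powr \<tau>) k n y" by (rule weight)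
    finally show ?thesis .
  qed
  moreover have "0 < c powr (\<tau> / t)" using c(1) by simp
  moreover have "0 \<le> \<alpha> * (\<tau> / t) + \<eta>" using \<open>0 \<le> \<alpha>\<close> \<eta>(2) pos by simp
  ultimately show ?thesis unfolding exponents_def by blast
qed

text \<open>The key to the lower bound: if \<open>\<alpha> = s\<close> stayed admissible for arbitrarily large \<open>t\<close>, then
  arbitrarily small exponents would be admissible, for some other \<open>t\<close>, and hence for \<open>X\<close>.\<close>

lemma exponents_large_parameter:
  assumes "0 < s" "0 < t1" "0 < \<epsilon>" and small: "branching * \<delta> powr t1 \<le> 1 / 2"
    and no_cover: "\<not> (\<exists>C::real. 0 < C \<and> (\<forall>(x::'a) r R. 0 < r \<and> r < R \<longrightarrow>
           ereal_of_enat (covering_number x R r) \<le> ereal (C * (R / r) powr \<epsilon>)))"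
  shows "\<exists>t\<ge>t1. s \<notin> exponents (\<delta> powr t)"
proof -
  \<comment> \<open>Half of \<epsilon> pays for the central edges in \<open>exponents_power\<close>,
    the other half for the rescaled exponent \<open>s * (\<tau> / t)\<close>.\<close>
  define \<eta> where "\<eta> = \<epsilon> / 2"
  have d1: "\<delta> powr \<eta> < 1"
    using delta_pos delta_le assms(3) powr_less_mono'[of \<delta> 0 \<eta>] by (simp add: \<eta>_def)
  \<comment> \<open>Solves
    \<open>branching * \<delta> powr \<tau>0 = 1 - \<delta> powr \<eta>\<close>, the borderline case
    for \<open>exponents_power\<close>.\<close>
  define \<tau>0 where "\<tau>0 = log \<delta> ((1 - \<delta> powr \<eta>) / branching)"
  define \<tau> where "\<tau> = max t1 \<tau>0"
  \<comment> \<open>Large enough that \<open>s * (\<tau> / t) \<le> \<eta>\<close>.\<close>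
  define t where "t = max \<tau> (s * \<tau> / \<eta>)"
  have \<tau>: "0 < \<tau>" "t1 \<le> \<tau>" "\<tau> \<le> t" using assms(2) by (simp_all add: \<tau>_def t_def)
  have small\<tau>: "branching * \<delta> powr \<tau> \<le> 1 / 2"
  proof -
    have "branching * \<delta> powr \<tau> \<le> branching * \<delta> powr t1"
      using branching_ge_1 \<tau> delta_pos delta_le by (intro mult_left_mono powr_mono') auto
    then show ?thesis using small by simp
  qed
  have "\<delta> powr \<tau> \<le> \<delta> powr \<tau>0"
    using delta_pos delta_le by (intro powr_mono') (auto simp: \<tau>_def)
  also have "\<dots> = (1 - \<delta> powr \<eta>) / branching"
    unfolding \<tau>0_def using delta_pos delta_le d1 branching_ge_1 by (intro powr_log_cancel) auto
  finally have "branching * \<delta> powr \<tau> \<le> branching * ((1 - \<delta> powr \<eta>) / branching)"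
    using branching_ge_1 by (intro mult_left_mono) auto
  then have \<eta>\<tau>: "\<delta> powr \<eta> \<le> 1 - branching * \<delta> powr \<tau>" using branching_ge_1 by simp
  have "s \<notin> exponents (\<delta> powr t)"
  proof
    assume s: "s \<in> exponents (\<delta> powr t)"
    have "s * (\<tau> / t) + \<eta> \<in> exponents (\<delta> powr \<tau>)"
      using \<eta>\<tau> \<tau> small\<tau> s assms(3) by (intro exponents_power) (auto simp: \<eta>_def)
    moreover have "s * (\<tau> / t) + \<eta> \<le> \<epsilon>"
    proof -
      have "s * \<tau> / \<eta> \<le> t" by (simp add: t_def)
      then have "s * (\<tau> / t) \<le> \<eta>" using \<tau> assms(3) by (simp add: field_simps \<eta>_def)
      moreover have "\<epsilon> = \<eta> + \<eta>" by (simp add: \<eta>_def)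
      ultimately show ?thesis by linarith
    qed
    ultimately have "\<epsilon> \<in> exponents (\<delta> powr \<tau>)" by (rule exponents_mono)
    moreover have "weighted_net_tree \<delta> net x0 K e (\<delta> powr \<tau>)"
      using small\<tau> delta_pos by unfold_locales auto
    ultimately show False using covering_number_le no_cover by blast
  qed
  then show ?thesis using \<tau> by (intro exI[of _ t]) auto
qed

lemma parameter_in_exponents:
  assumes "0 < t" "branching * \<delta> powr t \<le> 1 / 2"
  shows "t \<in> exponents (\<delta> powr t)"
proof -
  interpret T: weighted_net_tree \<delta> net x0 K e "\<delta> powr t"
    using assms delta_pos by unfold_locales auto
  show ?thesis unfolding exponents_def using assms(1) T.weight_ge by (auto intro!: exI[of _ "1::real"])
qed

lemma ex_parameter:
  assumes "0 < t1" "t1 < s" "0 < \<epsilon>" and small: "branching * \<delta> powr t1 \<le> 1 / 2"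
    and no_cover: "\<not> (\<exists>C::real. 0 < C \<and> (\<forall>(x::'a) r R. 0 < r \<and> r < R \<longrightarrow>
           ereal_of_enat (covering_number x R r) \<le> ereal (C * (R / r) powr \<epsilon>)))"
  obtains t where "t1 \<le> t" "Inf (exponents (\<delta> powr t)) = s"
proof -
  define f where "f t = Inf (exponents (\<delta> powr t))" for t
  have small_t: "branching * \<delta> powr t \<le> 1 / 2" if "t1 \<le> t" for t
  proof -
    have "branching * \<delta> powr t \<le> branching * \<delta> powr t1"
      using branching_ge_1 that delta_pos delta_le by (intro mult_left_mono powr_mono') auto
    then show ?thesis using small by simp
  qed
  have bdd: "bdd_below (exponents p)" for p by (auto simp: exponents_def intro!: bdd_belowI[of _ 0])
  have mem: "t \<in> exponents (\<delta> powr t)" if "t1 \<le> t" for t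
    using that assms(1) small_t by (intro parameter_in_exponents) auto
  have le: "f t' \<le> f t + \<bar>t - t'\<bar>" if "t1 \<le> t" "t1 \<le> t'" for t t'
  proof -
    have "f t' - \<bar>t - t'\<bar> \<le> f t"
      unfolding f_def[of t]
    proof (rule cInf_greatest)
      fix \<alpha> assume "\<alpha> \<in> exponents (\<delta> powr t)"
      then have "\<alpha> + \<bar>t - t'\<bar> \<in> exponents (\<delta> powr t')"
        using that assms(1) small_t by (intro exponents_lipschitz) auto
      then show "f t' - \<bar>t - t'\<bar> \<le> \<alpha>" using cInf_lower[OF _ bdd] by (fastforce simp: f_def)
    qed (use mem that in auto)
    then show ?thesis by simp
  qed
  obtain t2 where t2: "t1 \<le> t2" "s \<notin> exponents (\<delta> powr t2)"
    using exponents_large_parameter[of s t1 \<epsilon>] assms by auto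
  \<comment> \<open>\<open>exponents\<close> is closed upwards, so a number outside it is a lower
    bound.\<close>
  have "s \<le> f t2"
  proof (rule ccontr)
    assume "\<not> s \<le> f t2"
    moreover have "exponents (\<delta> powr t2) \<noteq> {}" using mem[OF t2(1)] by blast
    ultimately obtain \<alpha> where "\<alpha> \<in> exponents (\<delta> powr t2)" "\<alpha> < s"
      using cInf_lessD[of "exponents (\<delta> powr t2)" s] by (auto simp: f_def)
    then show False using exponents_mono[of \<alpha> _ s] t2(2) by simp
  qed
  moreover have "f t1 \<le> s"
    using cInf_lower[OF mem[of t1] bdd] assms(2) by (simp add: f_def)
  moreover have "continuous_on {t1..t2} f"
  proof -
    have "1-lipschitz_on {t1..t2} f"
    proof (rule lipschitz_onI)
      fix t t' assume "t \<in> {t1..t2}" "t' \<in> {t1..t2}"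
      then show "dist (f t) (f t') \<le> 1 * dist t t'"
        using le[of t t'] le[of t' t] by (auto simp: dist_real_def)
    qed simp
    then show ?thesis by (rule lipschitz_on_continuous_on)
  qed
  ultimately obtain t where "t1 \<le> t" "f t = s" using IVT'[of f t1 s t2] t2(1) by blast
  then show ?thesis using that by (simp add: f_def)
qed

end

section \<open>The Assouad dimension of the measure\<close>

context weighted_net_tree
begin

lemma cball_node_subset:
  assumes "dist x y < sc k" "sc k \<le> r / 3"
  shows "cball y (2 * sc k) \<subseteq> cball x r"
proof
  fix v assume "v \<in> cball y (2 * sc k)"
  then show "v \<in> cball x r" using assms dist_triangle[of x v y] by simp
qed

lemma \<mu>_finite: "emeasure \<mu> (cball x R) < \<infinity>"
proof -
  have "0 < max R 1" by simp
  then obtain i where i: "max R 1 < sc (i - 1)" using ex_scale by blast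
  obtain z where "z \<in> net (i - 1)" "dist x z < sc (i - 1)" using dense by blast
  then have "emeasure \<mu> (cball x R) \<le> ennreal (K * 3 powr e / p * mass (i - 1) z)"
    using i sc_pos[of "i - 1"] by (intro \<mu>_cball_le) (auto simp: dist_commute)
  also have "\<dots> < \<infinity>" by simp
  finally show ?thesis .
qed

lemma \<mu>_pos:
  assumes "0 < r"
  shows "0 < emeasure \<mu> (cball x r)"
proof -
  obtain k where k: "sc k \<le> r / 3" using ex_scale[of "r / 3"] assms by auto
  obtain y where y: "y \<in> net k" "dist x y < sc k" using dense by blast
  have "ennreal (mass k y) \<le> emeasure \<mu> (cball x r)"
    using y(1) cball_node_subset[OF y(2) k] by (intro \<mu>_ge_mass) auto
  moreover have "0 < ennreal (mass k y)" using mass_pos by simp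
  ultimately show ?thesis by (rule less_le_trans[rotated])
qed

text \<open>Up to constants, a ball has the mass of a node near its centre on its own scale. The
  masses of \<open>y\<close> and its ancestor \<open>up k n y\<close> are in the ratio
  \<open>weight p k n y\<close>, so both conditions bound the same quantity.\<close>

lemma exponents_iff:
  assumes "0 \<le> \<alpha>"
  shows "\<alpha> \<in> exponents p \<longleftrightarrow> (\<exists>C::real. \<forall>x r R. 0 < r \<and> r < R \<longrightarrow>
    emeasure \<mu> (cball x R) / emeasure \<mu> (cball x r) \<le> ennreal (C * (R / r) powr \<alpha>))"
proof
  define D where "D = K * 3 powr e / p"
  have D: "0 < D" using K_ge_1 p_pos by (simp add: D_def)
  have quotient_le: "a / b \<le> ennreal (A / B)" if "a \<le> ennreal A" "ennreal B \<le> b" "0 < B" "0 \<le> A"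
    for a b :: ennreal and A B
  proof -
    have "a / b \<le> ennreal A / ennreal B"
      using that(1,2) by (rule ennreal_divide_mono)
    then show ?thesis using that by (simp add: divide_ennreal)
  qed
  {
    assume "\<alpha> \<in> exponents p"
    then obtain c where c: "0 < c" "\<And>k n y. y \<in> net k \<Longrightarrow> c * (\<delta> powr \<alpha>) ^ n \<le> weight p k n y"
      unfolding exponents_def by blast
    have "emeasure \<mu> (cball x R) / emeasure \<mu> (cball x r)
      \<le> ennreal (D / (c * (\<delta>\<^sup>2 / 3) powr \<alpha>) * (R / r) powr \<alpha>)" if r: "0 < r" "r < R" for x r R
    proof -
      obtain j k n where j: "j = k - int n" and k: "sc k \<le> r / 3" "R < sc j"
        and ratio: "(\<delta>\<^sup>2 * (r / 3 / R)) powr \<alpha> \<le> (\<delta> powr \<alpha>) ^ n"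
      proof -
        have "0 < r / 3" "r / 3 < R" using r by simp_all
        then show ?thesis using scale_ratio[of "r / 3" R] assms that by metis
      qed
      obtain y where y: "y \<in> net k" "dist x y < sc k" using dense by blast
      define z where "z = up k n y"
      have z: "z \<in> net j" using up_in_net[OF y(1), of n] j by (simp add: z_def)
      have "sc k \<le> sc j" using j by (intro sc_antimono) simp
      then have "dist z x \<le> 3 * sc j"
        using dist_triangle2[of z x y] dist_up_le[of k n y] y(2) j by (simp add: z_def)
      then have upper: "emeasure \<mu> (cball x R) \<le> ennreal (D * mass j z)"
        unfolding D_def using z k(2) by (intro \<mu>_cball_le) auto
      have lower: "ennreal (mass k y) \<le> emeasure \<mu> (cball x r)"
        using y(1) cball_node_subset[OF y(2) k(1)] by (intro \<mu>_ge_mass) auto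
      have "emeasure \<mu> (cball x R) / emeasure \<mu> (cball x r) \<le> ennreal (D * mass j z / mass k y)"
        using upper lower mass_pos D by (intro quotient_le) (auto simp: less_imp_le)
      also have "D * mass j z / mass k y = D / weight p k n y"
        using mass_up[of k y n] mass_pos[of j z] by (simp add: j z_def)
      also have "\<dots> \<le> D / (c * (\<delta>\<^sup>2 * (r / 3 / R)) powr \<alpha>)"
      proof (rule divide_left_mono)
        have "c * (\<delta>\<^sup>2 * (r / 3 / R)) powr \<alpha> \<le> c * (\<delta> powr \<alpha>) ^ n"
          using ratio c(1) by simp
        then show "c * (\<delta>\<^sup>2 * (r / 3 / R)) powr \<alpha> \<le> weight p k n y" using c(2)[OF y(1), of n] by simp
        show "0 < weight p k n y * (c * (\<delta>\<^sup>2 * (r / 3 / R)) powr \<alpha>)"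
          using weight_pos c(1) r delta_pos by simp
      qed (use D in simp)
      also have "\<dots> = D / (c * (\<delta>\<^sup>2 / 3) powr \<alpha>) * (R / r) powr \<alpha>"
        using r delta_pos by (simp add: powr_mult powr_divide field_simps)
      finally show ?thesis by (simp add: ennreal_leI)
    qed
    then show "\<exists>C::real. \<forall>x r R. 0 < r \<and> r < R \<longrightarrow>
      emeasure \<mu> (cball x R) / emeasure \<mu> (cball x r) \<le> ennreal (C * (R / r) powr \<alpha>)" by blast
  }
  {
    assume "\<exists>C::real. \<forall>x r R. 0 < r \<and> r < R \<longrightarrow>
      emeasure \<mu> (cball x R) / emeasure \<mu> (cball x r) \<le> ennreal (C * (R / r) powr \<alpha>)"
    then obtain C where C: "emeasure \<mu> (cball x R) / emeasure \<mu> (cball x r) \<le> ennreal (C * (R / r) powr \<alpha>)"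
      if "0 < r" "r < R" for x r R by blast
    \<comment> \<open>\<open>ennreal\<close> sends negative reals to 0, so \<open>C\<close> is made
      positive before the inequality is read back over the reals.\<close>
    define C' where "C' = max C 1"
    have C': "0 < C'" by (simp add: C'_def)
    have "1 / (D * C' * 4 powr \<alpha>) * (\<delta> powr \<alpha>) ^ n \<le> weight p k n y" if y: "y \<in> net k" for k n y
    proof -
      define j z where "j = k - int n" and "z = up k n y"
      have z: "z \<in> net j" using up_in_net[OF y, of n] by (simp add: j_def z_def)
      \<comment> \<open>The hypothesis is tested on balls around \<open>y\<close> of radii
        \<open>sc k\<close> and \<open>4 * sc j\<close>. The larger one contains the endpoints of
        all paths through \<open>z\<close>, and the radii differ even for
        \<open>n = 0\<close>.\<close>
      have "cball z (2 * sc j) \<subseteq> cball y (4 * sc j)"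
      proof
        fix v assume "v \<in> cball z (2 * sc j)"
        then show "v \<in> cball y (4 * sc j)"
          using dist_up_le[of k n y] dist_triangle[of y v z] by (simp add: j_def z_def dist_commute)
      qed
      then have lower: "ennreal (mass j z) \<le> emeasure \<mu> (cball y (4 * sc j))"
        using z by (intro \<mu>_ge_mass) auto
      have upper: "emeasure \<mu> (cball y (sc k)) \<le> ennreal (D * mass k y)"
        unfolding D_def using y sc_pos[of k] by (intro \<mu>_cball_le) auto
      have "sc k \<le> sc j" by (intro sc_antimono) (simp add: j_def)
      then have less: "0 < sc k" "sc k < 4 * sc j" using sc_pos[of k] by simp_all
      have sc: "sc j / sc k = 1 / \<delta> ^ n"
        using sc_diff_nat[of k n] sc_pos[of j] delta_pos by (simp add: j_def field_simps)
      have "ennreal (mass j z / (D * mass k y)) = ennreal (mass j z) / ennreal (D * mass k y)"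
        using mass_pos D by (simp add: divide_ennreal less_imp_le)
      also have "\<dots> \<le> emeasure \<mu> (cball y (4 * sc j)) / emeasure \<mu> (cball y (sc k))"
        using lower upper by (rule ennreal_divide_mono)
      also have "\<dots> \<le> ennreal (C * (4 * sc j / sc k) powr \<alpha>)" using less by (rule C)
      also have "\<dots> \<le> ennreal (C' * (4 * sc j / sc k) powr \<alpha>)"
        by (intro ennreal_leI mult_right_mono) (auto simp: C'_def)
      finally have "mass j z / (D * mass k y) \<le> C' * (4 * sc j / sc k) powr \<alpha>"
        using C' by (subst (asm) ennreal_le_iff) auto
      also have "mass j z / (D * mass k y) = 1 / (D * weight p k n y)"
        using mass_up[of k y n] mass_pos[of j z] by (simp add: j_def z_def)
      also have "(4 * sc j / sc k) powr \<alpha> = 4 powr \<alpha> / (\<delta> powr \<alpha>) ^ n"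
      proof -
        have "4 * sc j / sc k = 4 / \<delta> ^ n" using arg_cong[OF sc, of "\<lambda>x. 4 * x"] by simp
        then have "(4 * sc j / sc k) powr \<alpha> = (4 / \<delta> ^ n) powr \<alpha>" by (rule arg_cong)
        also have "\<dots> = 4 powr \<alpha> / (\<delta> ^ n) powr \<alpha>" using delta_pos by (simp add: powr_divide)
        also have "(\<delta> ^ n) powr \<alpha> = (\<delta> powr \<alpha>) ^ n"
          using delta_pos by (simp flip: powr_realpow add: powr_powr mult.commute)
        finally show ?thesis .
      qed
      finally have *: "1 / (D * weight p k n y) \<le> C' * (4 powr \<alpha> / (\<delta> powr \<alpha>) ^ n)" .
      define q b where "q = (\<delta> powr \<alpha>) ^ n" and "b = (4::real) powr \<alpha>"
      have "0 < q" "0 < b" using delta_pos by (simp_all add: q_def b_def)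
      then show ?thesis
        using * D C' weight_pos[of k n y] unfolding q_def[symmetric] b_def[symmetric]
        by (simp add: field_simps)
    qed
    moreover have "0 < 1 / (D * C' * 4 powr \<alpha>)" using D C' by simp
    ultimately show "\<alpha> \<in> exponents p" unfolding exponents_def using assms by blast
  }
qed

end

section \<open>Construction of the tree and conclusion\<close>

lemma ex_net_tree:
  assumes "0 \<le> e" "e < t"
    and C: "0 < C" "\<And>(x::'a::complete_space) r R. 0 < r \<Longrightarrow> r < R \<Longrightarrow>
          ereal_of_enat (covering_number x R r) \<le> ereal (C * (R / r) powr e)"
  obtains \<delta> and net :: "int \<Rightarrow> 'a::complete_space set" and x0 K
  where "net_tree \<delta> net x0 K e" "K * (1 / \<delta>) powr e * \<delta> powr t \<le> 1 / 2"
proof -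
  fix x0 :: 'a
  \<comment> \<open>The 3 comes from covering by balls of radius \<open>\<delta> powi k / 3\<close>,
    small enough to separate net points. \<open>K\<close> does not involve \<delta>, which can
    therefore be chosen afterwards.\<close>
  define K where "K = C * 3 powr e"
  have "0 < K" using C(1) by (simp add: K_def)
  \<comment> \<open>The second term forces \<open>\<delta> powr (t - e) \<le> 1 / (2 * K)\<close>,
    which is possible because \<open>e < t\<close>.\<close>
  define \<delta> where "\<delta> = min (1 / 24) ((1 / (2 * K)) powr (1 / (t - e)))"
  have \<delta>: "0 < \<delta>" "\<delta> \<le> 1 / 24" "\<delta> \<le> (1 / (2 * K)) powr (1 / (t - e))" using \<open>0 < K\<close> by (simp_all add: \<delta>_def)
  have "\<exists>net. \<forall>k. x0 \<in> net k \<and> (\<forall>x\<in>net k. \<forall>y\<in>net k. x \<noteq> y \<longrightarrow> \<delta> powi k \<le> dist x y) \<and>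
    (\<forall>x. \<exists>y\<in>net k. dist x y < \<delta> powi k)"
  proof (rule choice, rule allI)
    fix k :: int
    have "0 < \<delta> powi k" using \<delta>(1) by (simp add: zero_less_power_int)
    then show "\<exists>S. x0 \<in> S \<and> (\<forall>x\<in>S. \<forall>y\<in>S. x \<noteq> y \<longrightarrow> \<delta> powi k \<le> dist x y) \<and>
      (\<forall>x. \<exists>y\<in>S. dist x y < \<delta> powi k)"
      by (rule ex_maximal_separated[of _ x0]) blast
  qed
  then obtain net where *: "\<forall>k. x0 \<in> net k \<and>
    (\<forall>x\<in>net k. \<forall>y\<in>net k. x \<noteq> y \<longrightarrow> \<delta> powi k \<le> dist x y) \<and>
    (\<forall>x. \<exists>y\<in>net k. dist x y < \<delta> powi k)" ..
  have net: "x0 \<in> net k" "x \<in> net k \<Longrightarrow> y \<in> net k \<Longrightarrow> x \<noteq> y \<Longrightarrow> \<delta> powi k \<le> dist x y"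
    "\<exists>y\<in>net k. dist x y < \<delta> powi k" for k x y
    using * by simp_all
  have card: "finite (net k \<inter> cball x (\<rho> * \<delta> powi k)) \<and>
      card (net k \<inter> cball x (\<rho> * \<delta> powi k)) \<le> K * \<rho> powr e" if "1 \<le> \<rho>" for \<rho> k x
  proof -
    have pos: "0 < \<delta> powi k" using \<delta>(1) by (simp add: zero_less_power_int)
    have "ereal_of_enat (covering_number x (\<rho> * \<delta> powi k) (\<delta> powi k / 3))
        \<le> ereal (C * (\<rho> * \<delta> powi k / (\<delta> powi k / 3)) powr e)"
      using that pos mult_right_mono[OF that, of "\<delta> powi k"] by (intro C(2)) auto
    also have "C * (\<rho> * \<delta> powi k / (\<delta> powi k / 3)) powr e = K * \<rho> powr e"
      using \<delta>(1) that by (simp add: K_def powr_mult)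
    finally have cov: "ereal_of_enat (covering_number x (\<rho> * \<delta> powi k) (\<delta> powi k / 3))
        \<le> ereal (K * \<rho> powr e)" .
    have sep: "2 * (\<delta> powi k / 3) < dist u v" if "u \<in> net k" "v \<in> net k" "u \<noteq> v" for u v
      using net(2)[OF that] pos by simp
    show ?thesis using card_separated_le_covering_number[OF sep cov] by blast
  qed
  have "net_tree \<delta> net x0 K e"
  proof
    show "finite (net k \<inter> cball x R)" for k x R
    proof (rule finite_subset)
      have pos: "0 < \<delta> powi k" using \<delta>(1) by (simp add: zero_less_power_int)
      show "finite (net k \<inter> cball x (max 1 (R / \<delta> powi k) * \<delta> powi k))"
        using card[of "max 1 (R / \<delta> powi k)"] by simp
      have "R \<le> max 1 (R / \<delta> powi k) * \<delta> powi k"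
        using pos by (simp flip: pos_divide_le_eq)
      then show "net k \<inter> cball x R \<subseteq> net k \<inter> cball x (max 1 (R / \<delta> powi k) * \<delta> powi k)"
        by auto
    qed
    show "0 < \<delta>" "\<delta> \<le> 1 / 24" by (rule \<delta>(1), rule \<delta>(2))
    show "x0 \<in> net k" for k by (rule net(1))
    show "\<delta> powi k \<le> dist x y" if "x \<in> net k" "y \<in> net k" "x \<noteq> y" for x y k
      using that by (rule net(2))
    show "\<exists>y\<in>net k. dist x y < \<delta> powi k" for x k by (rule net(3))
    show "card (net k \<inter> cball x (\<rho> * \<delta> powi k)) \<le> K * \<rho> powr e" if "1 \<le> \<rho>" for \<rho> k x
      using card[OF that] by blast
  qed
  moreover have "K * (1 / \<delta>) powr e * \<delta> powr t \<le> 1 / 2"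
  proof -
    have "\<delta> powr (t - e) \<le> ((1 / (2 * K)) powr (1 / (t - e))) powr (t - e)"
      using \<delta> assms(2) by (intro powr_mono2) auto
    also have "\<dots> = 1 / (2 * K)" using assms(2) \<open>0 < K\<close> by (simp add: powr_powr)
    finally have "K * \<delta> powr (t - e) \<le> K * (1 / (2 * K))" using \<open>0 < K\<close> by (intro mult_left_mono) auto
    then show ?thesis using \<delta>(1) \<open>0 < K\<close> by (simp add: powr_divide powr_diff)
  qed
  ultimately show ?thesis by (rule that)
qed

theorem theorem1p1:
  assumes "0 < assouad_dim TYPE('a::complete_space)"
    and "assouad_dim TYPE('a) < \<infinity>"
  shows "\<forall>s::real. assouad_dim TYPE('a) < ereal s \<longrightarrow>
    (\<exists>\<mu> :: 'a set \<Rightarrow> ennreal.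
       borel_regular_outer_measure \<mu> \<and>
       (\<forall>x r. \<mu> (cball x r) < \<infinity>) \<and>
       spt \<mu> = UNIV \<and>
       assouad_dim_measure \<mu> = ereal s)"
proof (intro allI impI)
  fix s :: real
  assume s: "assouad_dim TYPE('a) < ereal s"
  define admissible where "admissible \<alpha> \<longleftrightarrow> (\<exists>C::real. 0 < C \<and>
    (\<forall>(x::'a) r R. 0 < r \<and> r < R \<longrightarrow>
      ereal_of_enat (covering_number x R r) \<le> ereal (C * (R / r) powr \<alpha>)))" for \<alpha> :: real
  have dim: "assouad_dim TYPE('a) = Inf {ereal \<alpha> |\<alpha>. 0 \<le> \<alpha> \<and> admissible \<alpha>}"
    unfolding assouad_dim_def admissible_def ..
  obtain e where e: "0 \<le> e" "e < s" "admissible e"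
    using s unfolding dim Inf_less_iff by auto
  \<comment> \<open>Positivity of the dimension supplies the positive, non-admissible exponent that
    \<open>ex_parameter\<close> requires.\<close>
  obtain \<epsilon> where \<epsilon>: "0 < \<epsilon>" "ereal \<epsilon> < assouad_dim TYPE('a)"
    using ereal_dense2[OF assms(1)] by auto
  have not_adm: "\<not> admissible \<epsilon>"
  proof
    assume "admissible \<epsilon>"
    then have "assouad_dim TYPE('a) \<le> ereal \<epsilon>" unfolding dim using \<epsilon>(1) by (intro Inf_lower) auto
    then show False using \<epsilon>(2) by simp
  qed
  \<comment> \<open>\<open>e < t1\<close> allows \<delta> to be chosen in
    \<open>ex_net_tree\<close>, and \<open>t1 < s\<close> starts the intermediate value argument
    below \<open>s\<close>.\<close>
  define t1 where "t1 = (e + s) / 2"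
  have t1: "0 < t1" "e < t1" "t1 < s" using e by (simp_all add: t1_def)
  obtain C where C: "0 < C" "\<And>(x::'a) r R. 0 < r \<Longrightarrow> r < R \<Longrightarrow>
      ereal_of_enat (covering_number x R r) \<le> ereal (C * (R / r) powr e)"
    using e(3) unfolding admissible_def by blast
  obtain \<delta> and net :: "int \<Rightarrow> 'a set" and x0 K
    where tree: "net_tree \<delta> net x0 K e" and small: "K * (1 / \<delta>) powr e * \<delta> powr t1 \<le> 1 / 2"
    using C by (rule ex_net_tree[OF e(1) t1(2)])
  interpret net_tree \<delta> net x0 K e by (rule tree)
  have small: "branching * \<delta> powr t1 \<le> 1 / 2" using small by (simp add: branching_def)
  obtain t where t: "t1 \<le> t" "Inf (exponents (\<delta> powr t)) = s"
    using ex_parameter[OF t1(1,3) \<epsilon>(1) small not_adm[unfolded admissible_def]] by blast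
  have "branching * \<delta> powr t \<le> branching * \<delta> powr t1"
    using branching_ge_1 t(1) delta_pos delta_le by (intro mult_left_mono powr_mono') auto
  then have small_t: "branching * \<delta> powr t \<le> 1 / 2" using small by simp
  interpret weighted_net_tree \<delta> net x0 K e "\<delta> powr t"
    using small_t delta_pos by unfold_locales auto
  let ?\<mu> = "outer_measure_of \<mu>"
  have cball: "?\<mu> (cball x r) = emeasure \<mu> (cball x r)" for x r by simp
  have "assouad_dim_measure ?\<mu> = Inf (ereal ` exponents (\<delta> powr t))"
  proof -
    have "{ereal \<alpha> |\<alpha>. 0 \<le> \<alpha> \<and> (\<exists>C::real. \<forall>x r R. 0 < r \<and> r < R \<longrightarrow>
         ?\<mu> (cball x R) / ?\<mu> (cball x r) \<le> ennreal (C * (R / r) powr \<alpha>))}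
      = {ereal \<alpha> |\<alpha>. 0 \<le> \<alpha> \<and> \<alpha> \<in> exponents (\<delta> powr t)}"
      unfolding cball using exponents_iff by blast
    also have "\<dots> = ereal ` exponents (\<delta> powr t)" by (auto simp: exponents_def)
    finally show ?thesis unfolding assouad_dim_measure_def by (rule arg_cong)
  qed
  \<comment> \<open>The set is nonempty and bounded below, so its infima in the reals and in
    \<open>ereal\<close> agree.\<close>
  also have "\<dots> = ereal s"
  proof -
    have "bdd_below (exponents (\<delta> powr t))"
      by (auto simp: exponents_def intro!: bdd_belowI[of _ 0])
    moreover have "exponents (\<delta> powr t) \<noteq> {}"
      using parameter_in_exponents[of t] t1 t small_t by auto
    ultimately show ?thesis using ereal_Inf' t(2) by metis
  qed
  finally have "assouad_dim_measure ?\<mu> = ereal s" .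
  moreover have "spt ?\<mu> = UNIV" unfolding spt_def cball using \<mu>_pos by auto
  moreover have "\<forall>x r. ?\<mu> (cball x r) < \<infinity>" unfolding cball using \<mu>_finite by blast
  moreover have "borel_regular_outer_measure ?\<mu>" by (simp add: borel_regular_outer_measure_of)
  ultimately show "\<exists>\<mu> :: 'a set \<Rightarrow> ennreal. borel_regular_outer_measure \<mu> \<and>
       (\<forall>x r. \<mu> (cball x r) < \<infinity>) \<and> spt \<mu> = UNIV \<and> assouad_dim_measure \<mu> = ereal s"
    by blast
qed

end
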